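(* Let $G$ be a finite 2-generated group. Then the generating graph $\Gamma(G)$ is planar if and only if $G$ is isomorphic to one of the following groups: $C_2$, $C_3$, $C_4$, $C_5$, $C_6$, $C_2\times C_2$, $D_4$, $Q_8$, $C_4\times C_2$, $D_3$, $D_6$.
   Context: For a finite group $G$, the generating graph $\Gamma(G)$ is the graph whose vertices are the non-identity elements of $G$, two vertices being adjacent if and only if they are distinct and generate $G$. A graph is planar if it can be drawn in the plane so that its edges intersect only at their ends. A group is 2-generated if it can be generated by two elements (so cyclic groups are included). $C_n$ denotes the cyclic group of order $n$, $D_n$ the dihedral group of order $2n$, and $Q_8$ the quaternion group (of order $8$).
   Formalization: The group G is assumed nontrivial: the trivial group is finite and 2-generated, its generating graph has no vertices and so is planar, but it is not in the list. *)

theory Defs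
  imports
    "HOL-Analysis.Path_Connected"
    "HOL-Algebra.Elementary_Groups"
    "HOL-Algebra.Generated_Groups"
    "Graph_Theory.Pair_Digraph"
begin

definition two_generated :: "('a, 'b) monoid_scheme \<Rightarrow> bool" where
  "two_generated G \<longleftrightarrow> (\<exists>x\<in>carrier G. \<exists>y\<in>carrier G. generate G {x, y} = carrier G)"

text \<open>As usual in \<^theory>\<open>Graph_Theory.Digraph\<close>, an undirected graph is a symmetric digraph.\<close>

definition generating_graph :: "('a, 'b) monoid_scheme \<Rightarrow> 'a pair_pre_digraph" where
  "generating_graph G =
    \<lparr> pverts = carrier G - {\<one>\<^bsub>G\<^esub>},
      parcs = {(x, y). x \<in> carrier G - {\<one>\<^bsub>G\<^esub>} \<and> y \<in> carrier G - {\<one>\<^bsub>G\<^esub>} \<and>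
                 x \<noteq> y \<and> generate G {x, y} = carrier G} \<rparr>"

lemma graph_generating_graph:
  assumes "finite (carrier G)"
  shows "graph (with_proj (generating_graph G))"
proof -
  have sub: "parcs (generating_graph G) \<subseteq> carrier G \<times> carrier G"
    unfolding generating_graph_def by auto
  have fin: "finite (parcs (generating_graph G))"
    by (rule finite_subset[OF sub]) (simp add: assms)
  have sym: "sym (parcs (generating_graph G))"
  proof (rule symI)
    fix x y assume "(x, y) \<in> parcs (generating_graph G)"
    moreover have "{y, x} = {x, y}"
      by blast
    ultimately show "(y, x) \<in> parcs (generating_graph G)"
      unfolding generating_graph_def by auto
  qed
  show ?thesis
  proof
    fix e assume "e \<in> arcs (with_proj (generating_graph G))"
    then show "tail (with_proj (generating_graph G)) e \<in> verts (with_proj (generating_graph G))"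
      and "head (with_proj (generating_graph G)) e \<in> verts (with_proj (generating_graph G))"
      and "tail (with_proj (generating_graph G)) e \<noteq> head (with_proj (generating_graph G)) e"
      by (simp_all add: generating_graph_def case_prod_beta)
  next
    show "finite (verts (with_proj (generating_graph G)))"
      using assms by (simp add: generating_graph_def)
    show "finite (arcs (with_proj (generating_graph G)))"
      using fin by simp
    show "symmetric (with_proj (generating_graph G))"
      using sym by (simp add: symmetric_def)
  qed (simp add: arc_to_ends_def)
qed

text \<open>
  A drawing places the vertices at distinct points and each edge along a simple arc joining its
  ends. The arc is indexed by the unordered pair of ends, so that the two opposite arcs \<open>(u, v)\<close>
  and \<open>(v, u)\<close> representing an undirected edge are drawn as one curve. The plane is the type
  \<^typ>\<open>complex\<close>. The notion is meant for symmetric digraphs without loops.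
\<close>

definition plane_drawing ::
    "'a pair_pre_digraph \<Rightarrow> ('a \<Rightarrow> complex) \<Rightarrow> ('a set \<Rightarrow> real \<Rightarrow> complex) \<Rightarrow> bool" where
  "plane_drawing H p \<gamma> \<longleftrightarrow>
     inj_on p (pverts H) \<and>
     (\<forall>(u, v)\<in>parcs H.
        arc (\<gamma> {u, v}) \<and>
        {pathstart (\<gamma> {u, v}), pathfinish (\<gamma> {u, v})} = {p u, p v} \<and>
        path_image (\<gamma> {u, v}) \<inter> p ` pverts H = {p u, p v}) \<and>
     (\<forall>(u, v)\<in>parcs H. \<forall>(x, y)\<in>parcs H. {u, v} \<noteq> {x, y} \<longrightarrow>
        path_image (\<gamma> {u, v}) \<inter> path_image (\<gamma> {x, y}) \<subseteq> p ` ({u, v} \<inter> {x, y}))"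

definition planar :: "'a pair_pre_digraph \<Rightarrow> bool" where
  "planar H \<longleftrightarrow> (\<exists>p \<gamma>. plane_drawing H p \<gamma>)"

text \<open>
  The dihedral group of order \<open>2n\<close> (for \<open>n \<ge> 1\<close>) is the semidirect product of the integers modulo
  \<open>n\<close> with a group of order 2 acting by inversion: \<open>(i, False)\<close> is the rotation \<open>r\<^sup>i\<close> and
  \<open>(i, True)\<close> the reflection \<open>r\<^sup>i s\<close>, where \<open>s r s = r\<^sup>-\<^sup>1\<close>.
\<close>

definition dihedral_group :: "nat \<Rightarrow> (int \<times> bool) monoid" where
  "dihedral_group n =
    \<lparr> carrier = {0..<int n} \<times> UNIV,
      monoid.mult = (\<lambda>(i, a) (j, b). ((if a then i - j else i + j) mod int n, a \<noteq> b)),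
      one = (0, False) \<rparr>"

lemma group_dihedral_group:
  assumes "n > 0"
  shows "group (dihedral_group n)"
proof (rule groupI)
  fix x assume x: "x \<in> carrier (dihedral_group n)"
  obtain i a where "x = (i, a)" by fastforce
  then have "(if a then i else (- i) mod int n, a) \<in> carrier (dihedral_group n) \<and>
      (if a then i else (- i) mod int n, a) \<otimes>\<^bsub>dihedral_group n\<^esub> x = \<one>\<^bsub>dihedral_group n\<^esub>"
    using x assms by (auto simp: dihedral_group_def mod_simps)
  then show "\<exists>y\<in>carrier (dihedral_group n). y \<otimes>\<^bsub>dihedral_group n\<^esub> x = \<one>\<^bsub>dihedral_group n\<^esub>"
    by blast
next
  fix x y z
  show "x \<otimes>\<^bsub>dihedral_group n\<^esub> y \<otimes>\<^bsub>dihedral_group n\<^esub> z =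
      x \<otimes>\<^bsub>dihedral_group n\<^esub> (y \<otimes>\<^bsub>dihedral_group n\<^esub> z)"
    by (cases x; cases y; cases z) (auto simp: dihedral_group_def mod_simps add.assoc
      diff_diff_eq diff_diff_eq2 add_diff_eq diff_add_eq)
qed (use assms in \<open>auto simp: dihedral_group_def\<close>)

lemma order_dihedral_group: "order (dihedral_group n) = 2 * n"
  by (simp add: order_def dihedral_group_def card_cartesian_product)

text \<open>
  The tuple \<open>(a, b, c, d)\<close> stands for the quaternion \<open>a + b i + c j + d k\<close>; the product is
  Hamilton's.
\<close>

fun quaternion_mult ::
    "int \<times> int \<times> int \<times> int \<Rightarrow> int \<times> int \<times> int \<times> int \<Rightarrow> int \<times> int \<times> int \<times> int" where
  "quaternion_mult (a, b, c, d) (a', b', c', d') =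
    (a * a' - b * b' - c * c' - d * d',
     a * b' + b * a' + c * d' - d * c',
     a * c' - b * d' + c * a' + d * b',
     a * d' + b * c' - c * b' + d * a')"

definition quaternion_group :: "(int \<times> int \<times> int \<times> int) monoid" where
  "quaternion_group =
    \<lparr> carrier = {(1, 0, 0, 0), (-1, 0, 0, 0), (0, 1, 0, 0), (0, -1, 0, 0),
                 (0, 0, 1, 0), (0, 0, -1, 0), (0, 0, 0, 1), (0, 0, 0, -1)},
      monoid.mult = quaternion_mult,
      one = (1, 0, 0, 0) \<rparr>"

lemma quaternion_mult_assoc:
  "quaternion_mult (quaternion_mult x y) z = quaternion_mult x (quaternion_mult y z)"
proof -
  obtain a b c d a' b' c' d' a'' b'' c'' d''
    where "x = (a, b, c, d)" "y = (a', b', c', d')" "z = (a'', b'', c'', d'')"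
    by (cases x; cases y; cases z) auto
  then show ?thesis
    by (simp only: quaternion_mult.simps prod.inject)
      (simp add: distrib_left distrib_right left_diff_distrib right_diff_distrib mult.assoc)
qed

lemma group_quaternion_group: "group quaternion_group"
proof (rule groupI)
  have "\<forall>x\<in>carrier quaternion_group. \<forall>y\<in>carrier quaternion_group.
      x \<otimes>\<^bsub>quaternion_group\<^esub> y \<in> carrier quaternion_group"
    by (simp add: quaternion_group_def)
  then show "x \<otimes>\<^bsub>quaternion_group\<^esub> y \<in> carrier quaternion_group"
    if "x \<in> carrier quaternion_group" "y \<in> carrier quaternion_group" for x y
    using that by blast
next
  have "\<forall>x\<in>carrier quaternion_group. \<exists>y\<in>carrier quaternion_group.
      y \<otimes>\<^bsub>quaternion_group\<^esub> x = \<one>\<^bsub>quaternion_group\<^esub>"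
    by (simp add: quaternion_group_def)
  then show "\<exists>y\<in>carrier quaternion_group.
      y \<otimes>\<^bsub>quaternion_group\<^esub> x = \<one>\<^bsub>quaternion_group\<^esub>"
    if "x \<in> carrier quaternion_group" for x
    using that by blast
next
  have "\<forall>x\<in>carrier quaternion_group. \<one>\<^bsub>quaternion_group\<^esub> \<otimes>\<^bsub>quaternion_group\<^esub> x = x"
    by (simp add: quaternion_group_def)
  then show "\<one>\<^bsub>quaternion_group\<^esub> \<otimes>\<^bsub>quaternion_group\<^esub> x = x"
    if "x \<in> carrier quaternion_group" for x
    using that by blast
qed (simp_all add: quaternion_group_def quaternion_mult_assoc del: quaternion_mult.simps)

lemma order_quaternion_group: "order quaternion_group = 8"
  by (simp add: order_def quaternion_group_def)

end

theory Submission
  imports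
    Defs
    "HOL-Analysis.Jordan_Curve"
    "HOL-Algebra.Multiplicative_Group"
    "HOL-Number_Theory.Cong"
begin

text \<open>
  A pair of generators \<open>(x, y)\<close> produces many others, such as \<open>(x\<^sup>i, y x\<^sup>j)\<close> for \<open>i\<close> coprime to the
  order of \<open>x\<close>. They yield a \<open>K\<^bsub>3,3\<^esub>\<close> in the generating graph of every group that is not listed, so no
  other obstruction to planarity is needed. If \<open>G\<close> is cyclic, a generator is joined to everything, and
  a cyclic group of order at least 7 has at least three generators. Suppose that \<open>G\<close> is not cyclic.
  Three generators of \<open>\<langle>x\<rangle>\<close> against \<open>y, y x, y x\<^sup>2\<close> show that \<open>x\<close> has order 2, 3, 4 or 6. If neither
  \<open>x\<close> nor \<open>y\<close> is an involution, the vertices \<open>x, x\<^sup>-\<^sup>1, x y\<close> against \<open>y, y\<^sup>-\<^sup>1, c\<close> with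
  \<open>c \<in> {x y x, x y x\<^sup>-\<^sup>1}\<close> form a \<open>K\<^bsub>3,3\<^esub>\<close> unless both choices of \<open>c\<close> lie in \<open>{y, y\<^sup>-\<^sup>1}\<close>; this makes
  \<open>G\<close> the quaternion group or a product of \<open>\<langle>x\<rangle>\<close> with the involution \<open>x y\<close>. If such a pair does not
  exist, two of \<open>x, y, x y\<close> are involutions and \<open>G\<close> is dihedral.

  Conversely, the generating graphs of the listed groups are, up to isolated vertices, subgraphs of
  bipyramids over a triangle, a square or a hexagon, which have straight-line drawings.
\<close>

section \<open>Complete bipartite subgraphs of planar graphs\<close>

lemma connected_component_near_closure:
  fixes S :: "'a::real_normed_vector set"
  assumes "open S" "x \<in> S" "x \<in> closure W"
  obtains w where "w \<in> W" "connected_component S w x"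
proof -
  obtain e where e: "e > 0" "ball x e \<subseteq> S"
    using assms openE by blast
  obtain w where w: "w \<in> W" "dist w x < e"
    using assms(3) e(1) by (meson closure_approachable)
  then have "w \<in> ball x e" "x \<in> ball x e"
    using e(1) by (auto simp: dist_commute)
  then have "connected_component S w x"
    using e(2) unfolding connected_component_def by (meson connected_ball)
  with w(1) show ?thesis using that by blast
qed

lemma connected_subset_separation:
  assumes "connected T" "T \<subseteq> V \<union> W" "open V" "open W" "V \<inter> W = {}" "T \<inter> V \<noteq> {}"
  shows "T \<subseteq> V"
  using assms connectedD[of T V W] by blast

text \<open>
  If \<open>z\<close> could reach all three arcs of a theta curve, take the component \<open>W\<close> of the complement of
  \<open>c1 \<union> c3\<close> that does not contain \<open>z\<close>. It is disjoint from \<open>c2\<close> and accumulates at \<open>q1\<close> and \<open>q3\<close>, so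
  some \<open>w \<in> W\<close> is connected to \<open>z\<close> outside \<open>c2 \<union> c3\<close> and outside \<open>c1 \<union> c2\<close>. These meet in the connected
  set \<open>c2\<close>, and Janiszewski's theorem connects \<open>z\<close> to \<open>w\<close> outside the whole curve.
\<close>

lemma theta_curve_no_common_region:
  fixes c1 c2 c3 :: "real \<Rightarrow> complex"
  assumes arcs: "arc c1" "arc c2" "arc c3"
    and ends: "pathstart c1 = a" "pathfinish c1 = b" "pathstart c2 = a" "pathfinish c2 = b"
      "pathstart c3 = a" "pathfinish c3 = b"
    and int12: "path_image c1 \<inter> path_image c2 \<subseteq> {a, b}"
    and int13: "path_image c1 \<inter> path_image c3 \<subseteq> {a, b}"
    and int23: "path_image c2 \<inter> path_image c3 \<subseteq> {a, b}"
    and q: "q1 \<in> path_image c1" "q2 \<in> path_image c2" "q3 \<in> path_image c3"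
    and z1: "connected_component (- (path_image c2 \<union> path_image c3)) z q1"
    and z2: "connected_component (- (path_image c1 \<union> path_image c3)) z q2"
    and z3: "connected_component (- (path_image c1 \<union> path_image c2)) z q3"
  shows False
proof -
  define C1 C2 C3 where "C1 = path_image c1" "C2 = path_image c2" "C3 = path_image c3"
  note C = this
  define J where "J = c1 +++ reversepath c3"
  have ab: "a \<in> C1" "b \<in> C1" "a \<in> C2" "b \<in> C2" "a \<in> C3" "b \<in> C3"
    using ends C pathstart_in_path_image[of c1] pathfinish_in_path_image[of c1]
      pathstart_in_path_image[of c2] pathfinish_in_path_image[of c2]
      pathstart_in_path_image[of c3] pathfinish_in_path_image[of c3] by simp_all
  have J: "simple_path J" "pathfinish J = pathstart J" "path_image J = C1 \<union> C3"
    using arcs ends int13 unfolding J_def C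
    by (auto intro!: simple_path_join_loop simp: arc_reversepath path_image_join)
  have cl: "closed C1" "closed C2" "closed C3" "compact C1" "compact C2" "compact C3"
    using arcs C by (auto simp: closed_arc_image compact_arc_image)
  have conn2: "connected C2" "connected (C2 - {a, b})"
    using arcs C ends connected_arc_image[of c2] connected_simple_path_endless[of c2] arc_imp_simple_path
    by auto
  \<comment> \<open>By the Jordan curve theorem the inside and the outside of \<open>J\<close> are
    open and connected and both have all of \<open>J\<close> as frontier. The properties kept are
    symmetric, so \<open>V\<close> may be whichever of the two contains \<open>z\<close>.\<close>
  obtain V W where VW: "open V" "open W" "connected W" "V \<inter> W = {}" "V \<union> W = - (C1 \<union> C3)"
      "frontier W = C1 \<union> C3" "z \<in> V"
  proof -
    let ?I = "inside (path_image J)" and ?O = "outside (path_image J)"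
    have jc: "open ?I" "open ?O" "connected ?I" "connected ?O" "?I \<inter> ?O = {}" "?I \<union> ?O = - (C1 \<union> C3)"
      "frontier ?I = C1 \<union> C3" "frontier ?O = C1 \<union> C3"
      using Jordan_inside_outside[OF J(1,2)] J(3) by auto
    have "z \<in> - (C1 \<union> C3)" using z2 C connected_component_in by blast
    then consider "z \<in> ?I" | "z \<in> ?O" using jc(6) by blast
    then show ?thesis
    proof cases
      case 1 then show ?thesis using that[of ?I ?O] jc by blast
    next
      case 2 then show ?thesis using that[of ?O ?I] jc by blast
    qed
  qed
  have stays: "y \<in> V" if y: "connected_component (- (C1 \<union> C3)) z y" for y
  proof -
    obtain T where "connected T" "T \<subseteq> - (C1 \<union> C3)" "z \<in> T" "y \<in> T"
      using y[unfolded connected_component_def] by (elim exE conjE)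
    moreover from this have "T \<subseteq> V \<union> W" "T \<inter> V \<noteq> {}" using VW(5,7) by auto
    ultimately show ?thesis using connected_subset_separation[of T V W] VW(1,2,4) by blast
  qed
  have "q2 \<in> V" using stays z2 C by simp
  moreover have "q2 \<in> C2 - {a, b}" using q(2) \<open>q2 \<in> V\<close> VW ab C by blast
  moreover have "C2 - {a, b} \<subseteq> V \<union> W" using VW(5) int12 int23 C by blast
  \<comment> \<open>The arc \<open>c2\<close> without its ends is connected, avoids \<open>J\<close>
    and meets \<open>V\<close> in \<open>q2\<close>, so it never enters \<open>W\<close>.\<close>
  ultimately have C2V: "C2 - {a, b} \<subseteq> V"
    using connected_subset_separation[OF conn2(2), of V W] VW(1,2,4) by blast
  have W_off: "W \<subseteq> - (C1 \<union> C2)"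
    using C2V VW ab by blast
  have clW: "q1 \<in> closure W" "q3 \<in> closure W"
    using VW(6) q C unfolding frontier_def by auto
  have "q1 \<in> - (C2 \<union> C3)" "q3 \<in> - (C1 \<union> C2)"
    using z1 z3 C connected_component_in by blast+
  moreover have "open (- (C2 \<union> C3))" "open (- (C1 \<union> C2))"
    using cl by (auto intro!: open_Compl closed_Un)
  ultimately obtain w w' where w: "w \<in> W" "connected_component (- (C2 \<union> C3)) w q1"
      and w': "w' \<in> W" "connected_component (- (C1 \<union> C2)) w' q3"
    using connected_component_near_closure clW by metis
  have "connected_component (- (C1 \<union> C2)) w w'"
    using VW(3) W_off w(1) w'(1) unfolding connected_component_def by blast
  then have "connected_component (- (C1 \<union> C2)) z w"
    using w'(2) z3 C by (metis connected_component_sym connected_component_trans)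
  moreover have "connected_component (- (C2 \<union> C3)) z w"
    using w(2) z1 C by (metis connected_component_sym connected_component_trans)
  moreover have "(C2 \<union> C3) \<inter> (C1 \<union> C2) = C2"
    using ab int13 C by blast
  ultimately have "connected_component (- ((C2 \<union> C3) \<union> (C1 \<union> C2))) z w"
    using Janiszewski[of "C2 \<union> C3" "C1 \<union> C2" z w] conn2 cl by (auto simp: compact_Un closed_Un)
  then have "connected_component (- (C1 \<union> C3)) z w"
    by (rule connected_component_of_subset) blast
  then show False using stays w(1) VW(4) by blast
qed

text \<open>The curve of an edge is indexed by the unordered pair of its ends, so its direction is
  unknown. Reversing it if necessary prepares edges for concatenation.\<close>

lemma plane_drawing_arc_between:
  assumes D: "plane_drawing H p \<gamma>" and e: "(u, v) \<in> parcs H"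
  obtains g where "arc g" "pathstart g = p u" "pathfinish g = p v" "path_image g = path_image (\<gamma> {u, v})"
proof -
  have *: "arc (\<gamma> {u, v})" "{pathstart (\<gamma> {u, v}), pathfinish (\<gamma> {u, v})} = {p u, p v}"
    using D e unfolding plane_drawing_def by auto
  show ?thesis
  proof (cases "pathstart (\<gamma> {u, v}) = p u \<and> pathfinish (\<gamma> {u, v}) = p v")
    case True then show ?thesis using that * by blast
  next
    case False
    then show ?thesis using that[of "reversepath (\<gamma> {u, v})"] *
      by (auto simp: doubleton_eq_iff arc_reversepath)
  qed
qed

text \<open>The arcs through the \<open>b\<^sub>i\<close> from \<open>a1\<close> to \<open>a2\<close> form a theta curve, and \<open>a3\<close> reaches every \<open>b\<^sub>i\<close>.\<close>

lemma planar_no_K33: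
  fixes H :: "'v pair_pre_digraph"
  assumes "planar H"
    and dist: "distinct [a1, a2, a3, b1, b2, b3]"
    and verts: "{a1, a2, a3, b1, b2, b3} \<subseteq> pverts H"
    and arcs: "\<And>x y. x \<in> {a1, a2, a3} \<Longrightarrow> y \<in> {b1, b2, b3} \<Longrightarrow> (x, y) \<in> parcs H"
  shows False
proof -
  obtain p \<gamma> where D: "plane_drawing H p \<gamma>" using assms(1) unfolding planar_def by blast
  define P where "P x y = path_image (\<gamma> {x, y})" for x y
  have int: "P x y \<inter> P x' y' \<subseteq> p ` ({x, y} \<inter> {x', y'})"
    if "(x, y) \<in> parcs H" "(x', y') \<in> parcs H" "{x, y} \<noteq> {x', y'}" for x y x' y'
    using D that unfolding plane_drawing_def P_def by fast
  \<comment> \<open>The edges from \<open>a1\<close> to \<open>b\<close> and from \<open>b\<close>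
    to \<open>a2\<close> share only the point \<open>p b\<close>, so their concatenation is again an
    arc.\<close>
  have link: "\<exists>c. arc c \<and> pathstart c = p a1 \<and> pathfinish c = p a2 \<and> path_image c = P a1 b \<union> P a2 b"
    if b: "b \<in> {b1, b2, b3}" for b
  proof -
    obtain g where g: "arc g" "pathstart g = p a1" "pathfinish g = p b" "path_image g = P a1 b"
      using plane_drawing_arc_between[OF D, of a1 b] arcs[of a1 b] b P_def by auto
    obtain h where h: "arc h" "pathstart h = p a2" "pathfinish h = p b" "path_image h = P a2 b"
      using plane_drawing_arc_between[OF D, of a2 b] arcs[of a2 b] b P_def by auto
    have "P a1 b \<inter> P a2 b \<subseteq> p ` ({a1, b} \<inter> {a2, b})"
      using int[of a1 b a2 b] arcs[of a1 b] arcs[of a2 b] b dist by (auto simp: doubleton_eq_iff)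
    also have "... \<subseteq> {p b}" using dist by auto
    finally have "arc (g +++ reversepath h)"
      using g h by (intro arc_join) (auto simp: arc_reversepath)
    then show ?thesis
      using g h by (intro exI[of _ "g +++ reversepath h"]) (auto simp: path_image_join)
  qed
  obtain c1 c2 c3 where
    c: "arc c1" "pathstart c1 = p a1" "pathfinish c1 = p a2" "path_image c1 = P a1 b1 \<union> P a2 b1"
       "arc c2" "pathstart c2 = p a1" "pathfinish c2 = p a2" "path_image c2 = P a1 b2 \<union> P a2 b2"
       "arc c3" "pathstart c3 = p a1" "pathfinish c3 = p a2" "path_image c3 = P a1 b3 \<union> P a2 b3"
    using link[of b1] link[of b2] link[of b3] by auto
  have ends_in: "p x \<in> P x y" "p y \<in> P x y" if "(x, y) \<in> parcs H" for x y
  proof -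
    have "{pathstart (\<gamma> {x, y}), pathfinish (\<gamma> {x, y})} = {p x, p y}"
      using D that unfolding plane_drawing_def by auto
    then show "p x \<in> P x y" "p y \<in> P x y"
      unfolding P_def by (metis insertCI insertE pathfinish_in_path_image pathstart_in_path_image singletonD)+
  qed
  have theta: "(P a1 b \<union> P a2 b) \<inter> (P a1 b' \<union> P a2 b') \<subseteq> {p a1, p a2}"
    if "b \<in> {b1, b2, b3}" "b' \<in> {b1, b2, b3}" "b \<noteq> b'" for b b'
  proof -
    have "P x b \<inter> P x' b' \<subseteq> {p a1, p a2}" if x: "x \<in> {a1, a2}" "x' \<in> {a1, a2}" for x x'
    proof -
      have "{x, b} \<noteq> {x', b'}" "{x, b} \<inter> {x', b'} \<subseteq> {a1, a2}"
        using x \<open>b \<in> _\<close> \<open>b' \<in> _\<close> \<open>b \<noteq> b'\<close> dist by (auto simp: doubleton_eq_iff)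
      moreover have "(x, b) \<in> parcs H" "(x', b') \<in> parcs H"
        using arcs[of x b] arcs[of x' b'] x \<open>b \<in> _\<close> \<open>b' \<in> _\<close> by auto
      ultimately have "P x b \<inter> P x' b' \<subseteq> p ` ({x, b} \<inter> {x', b'})" "p ` ({x, b} \<inter> {x', b'}) \<subseteq> p ` {a1, a2}"
        using int by blast+
      then show ?thesis by auto
    qed
    then show ?thesis by blast
  qed
  \<comment> \<open>The edge from \<open>a3\<close> to \<open>b''\<close> is itself a connected set
    that misses the arcs through the other two vertices.\<close>
  have conn: "connected_component (- ((P a1 b \<union> P a2 b) \<union> (P a1 b' \<union> P a2 b'))) (p a3) (p b'')"
    if "b \<in> {b1, b2, b3}" "b' \<in> {b1, b2, b3}" "b'' \<in> {b1, b2, b3}" "b \<noteq> b''" "b' \<noteq> b''" for b b' b''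
  proof -
    have "P a3 b'' \<inter> P x y = {}" if x: "x \<in> {a1, a2}" "y \<in> {b1, b2, b3}" "y \<noteq> b''" for x y
    proof -
      have "{a3, b''} \<inter> {x, y} = {}" using x \<open>b'' \<in> _\<close> dist by auto
      then show ?thesis
        using int[of a3 b'' x y] arcs[of a3 b''] arcs[of x y] x \<open>b'' \<in> _\<close> by (auto simp: doubleton_eq_iff)
    qed
    then have "P a3 b'' \<subseteq> - ((P a1 b \<union> P a2 b) \<union> (P a1 b' \<union> P a2 b'))"
      using that by blast
    moreover have "connected (P a3 b'')"
      using plane_drawing_arc_between[OF D, of a3 b''] arcs[of a3 b''] that(3) connected_arc_image
      unfolding P_def by (metis insertCI)
    ultimately show ?thesis
      using ends_in[of a3 b''] arcs[of a3 b''] that(3) unfolding connected_component_def by blast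
  qed
  have ne: "b1 \<noteq> b2" "b1 \<noteq> b3" "b2 \<noteq> b3" using dist by auto
  show False
  proof (rule theta_curve_no_common_region[of c1 c2 c3 "p a1" "p a2" "p b1" "p b2" "p b3" "p a3"])
    show "p b1 \<in> path_image c1" "p b2 \<in> path_image c2" "p b3 \<in> path_image c3"
      using c ends_in[of a1] arcs[of a1] by auto
  qed (use c ne theta conn in \<open>simp_all\<close>)
qed

section \<open>Straight-line drawings\<close>

text \<open>Twice the signed area of the triangle \<open>a\<close>, \<open>b\<close>,
  \<open>c\<close>. The ring is left open so that it can be evaluated on integer coordinates and
  interpreted over the reals.\<close>

definition cross :: "'a::comm_ring \<times> 'a \<Rightarrow> 'a \<times> 'a \<Rightarrow> 'a \<times> 'a \<Rightarrow> 'a" where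
  "cross a b c = (fst b - fst a) * (snd c - snd a) - (snd b - snd a) * (fst c - fst a)"

text \<open>No vertex other than its ends may lie on the whole line through an edge. This keeps
  vertices off foreign edges and makes edges with a common end meet only there. Of two edges without
  a common end, one must lie strictly on one side of the line through the other.\<close>

definition straight_line_check :: "(int \<times> int) list \<Rightarrow> (nat \<times> nat) list \<Rightarrow> bool" where
  "straight_line_check ps es \<longleftrightarrow> distinct ps \<and>
     (\<forall>(u, v)\<in>set es. u \<noteq> v \<and> u < length ps \<and> v < length ps \<and>
        (\<forall>w\<in>set [0..<length ps]. w = u \<or> w = v \<or> cross (ps ! u) (ps ! v) (ps ! w) \<noteq> 0)) \<and>
     (\<forall>(u, v)\<in>set es. \<forall>(x, y)\<in>set es. u = x \<or> u = y \<or> v = x \<or> v = y \<or>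
        cross (ps ! u) (ps ! v) (ps ! x) * cross (ps ! u) (ps ! v) (ps ! y) > 0 \<or>
        cross (ps ! x) (ps ! y) (ps ! u) * cross (ps ! x) (ps ! y) (ps ! v) > 0)"

text \<open>
  The apexes are \<open>0\<close> and \<open>n + 1\<close>, so that the vertices up to \<open>3\<close> of the triangular bipyramid form a
  complete graph. The drawings below place extra, isolated vertices after \<open>n + 1\<close>.
\<close>

definition bipyramid :: "nat \<Rightarrow> (nat \<times> nat) list" where
  "bipyramid n = [(1 + i, 1 + (i + 1) mod n). i \<leftarrow> [0..<n]] @ [(a, 1 + i). a \<leftarrow> [0, n + 1], i \<leftarrow> [0..<n]]"

text \<open>In all three drawings the rim edge between \<open>1\<close> and \<open>n\<close> lies on
  the vertical axis, the rest of the rim bulges to the right around the apex \<open>0\<close>, and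
  the apex \<open>n + 1\<close> is far enough to the right to see every rim vertex. The extra points
  lie to the left of the axis.\<close>

lemma straight_line_check_bipyramid3: "straight_line_check [(1,0),(0,-3),(2,1),(0,3),(5,1)] (bipyramid 3)"
  by code_simp

lemma straight_line_check_bipyramid4: "straight_line_check [(1,0),(0,-5),(2,-1),(2,1),(0,5),(9,0),(-1,3)] (bipyramid 4)"
  by code_simp

lemma straight_line_check_bipyramid6: "straight_line_check [(1,0),(0,-8),(3,-3),(4,-1),(4,1),(3,3),(0,8),(20,0),(-1,2),(-2,-5),(-3,11)] (bipyramid 6)"
  by code_simp

section \<open>Orientation tests for segments\<close>

definition orientation :: "complex \<Rightarrow> complex \<Rightarrow> complex \<Rightarrow> real" where
  "orientation a b c = cross (Re a, Im a) (Re b, Im b) (Re c, Im c)"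

lemma orientation_affine:
  "orientation a b ((1 - s) *\<^sub>R x + s *\<^sub>R y) = (1 - s) * orientation a b x + s * orientation a b y"
  by (simp add: orientation_def cross_def algebra_simps)

lemma orientation_on_line [simp]: "orientation a b a = 0" "orientation a b b = 0"
  by (simp_all add: orientation_def cross_def)

lemma orientation_segment:
  assumes "t \<in> closed_segment a b"
  shows "orientation a b t = 0"
proof -
  obtain s where "t = (1 - s) *\<^sub>R a + s *\<^sub>R b" using assms by (auto simp: in_segment)
  then show ?thesis by (simp only: orientation_affine orientation_on_line mult_zero_right add_0)
qed

lemma segments_meet_at_end:
  assumes "orientation u v w \<noteq> 0"
  shows "closed_segment u v \<inter> closed_segment u w = {u}"
proof -
  have "t = u" if t: "t \<in> closed_segment u v" "t \<in> closed_segment u w" for t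
  proof -
    obtain s where s: "t = (1 - s) *\<^sub>R u + s *\<^sub>R w" using t(2) by (auto simp: in_segment)
    have "s * orientation u v w = 0" using orientation_segment[OF t(1)] by (simp add: s orientation_affine)
    then show ?thesis using assms s by simp
  qed
  then show ?thesis by auto
qed

text \<open>Along the segment from \<open>x\<close> to \<open>y\<close> the orientation relative to
  \<open>u\<close> and \<open>v\<close> interpolates between two numbers of the same sign, so it
  never vanishes; on the segment from \<open>u\<close> to \<open>v\<close> it is zero.\<close>

lemma segment_one_side:
  assumes "orientation u v x * orientation u v y > 0"
  shows "closed_segment u v \<inter> closed_segment x y = {}"
proof -
  have False if t: "t \<in> closed_segment u v" "t \<in> closed_segment x y" for t
  proof -
    obtain s where s: "t = (1 - s) *\<^sub>R x + s *\<^sub>R y" "0 \<le> s" "s \<le> 1" using t(2) by (auto simp: in_segment)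
    define p q where "p = orientation u v x" and "q = orientation u v y"
    have "(1 - s) * p + s * q = 0"
      using orientation_segment[OF t(1)] by (simp only: s orientation_affine p_def q_def)
    \<comment> \<open>Multiplying by \<open>p\<close> treats both possible common signs at
      once.\<close>
    then have "((1 - s) * p + s * q) * p = 0" by simp
    then have "(1 - s) * (p * p) + s * (p * q) = 0" by (simp add: algebra_simps)
    moreover have "p * q > 0" "p * p > 0" using assms p_def q_def by (auto simp: zero_less_mult_iff)
    ultimately show False using s(2,3)
      by (smt (verit, best) mult_nonneg_nonneg mult_pos_pos)
  qed
  then show ?thesis by auto
qed

lemma planar_straight_line:
  assumes chk: "straight_line_check ps es"
    and inj: "inj_on f (pverts H)" and f: "f ` pverts H \<subseteq> {..<length ps}"
    and arcs: "\<And>u v. (u, v) \<in> parcs H \<Longrightarrow>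
      u \<in> pverts H \<and> v \<in> pverts H \<and> ((f u, f v) \<in> set es \<or> (f v, f u) \<in> set es)"
  shows "planar H"
proof -
  define q where "q i = Complex (of_int (fst (ps ! i))) (of_int (snd (ps ! i)))" for i
  define p where "p = q \<circ> f"
  have q_cross: "orientation (q i) (q j) (q k) = of_int (cross (ps ! i) (ps ! j) (ps ! k))" for i j k
    by (simp add: q_def orientation_def cross_def)
  have cross_swap: "cross b a c = - cross a b c" for a b c :: "int \<times> int"
    by (simp add: cross_def algebra_simps)
  have "distinct ps" using chk unfolding straight_line_check_def by blast
  have chk_line: "u \<noteq> v \<and> (w = u \<or> w = v \<or> cross (ps ! u) (ps ! v) (ps ! w) \<noteq> 0)"
    if "(u, v) \<in> set es" "w < length ps" for u v w
  proof -
    have "\<forall>(u, v)\<in>set es. u \<noteq> v \<and> u < length ps \<and> v < length ps \<and>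
        (\<forall>w\<in>set [0..<length ps]. w = u \<or> w = v \<or> cross (ps ! u) (ps ! v) (ps ! w) \<noteq> 0)"
      using chk unfolding straight_line_check_def by (elim conjE)
    from bspec[OF this that(1)] that(2) show ?thesis by simp
  qed
  have chk_sep: "u = x \<or> u = y \<or> v = x \<or> v = y \<or>
        cross (ps ! u) (ps ! v) (ps ! x) * cross (ps ! u) (ps ! v) (ps ! y) > 0 \<or>
        cross (ps ! x) (ps ! y) (ps ! u) * cross (ps ! x) (ps ! y) (ps ! v) > 0"
    if "(u, v) \<in> set es" "(x, y) \<in> set es" for u v x y
  proof -
    have "\<forall>(u, v)\<in>set es. \<forall>(x, y)\<in>set es. u = x \<or> u = y \<or> v = x \<or> v = y \<or>
        cross (ps ! u) (ps ! v) (ps ! x) * cross (ps ! u) (ps ! v) (ps ! y) > 0 \<or>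
        cross (ps ! x) (ps ! y) (ps ! u) * cross (ps ! x) (ps ! y) (ps ! v) > 0"
      using chk unfolding straight_line_check_def by (elim conjE)
    from bspec[OF this that(1)] that(2) show ?thesis by (simp only: prod.case) (drule (1) bspec, simp only: prod.case)
  qed
  have "inj_on q {..<length ps}"
  proof (rule inj_onI)
    fix i j assume ij: "i \<in> {..<length ps}" "j \<in> {..<length ps}" "q i = q j"
    then have "ps ! i = ps ! j" by (simp add: q_def prod_eq_iff)
    then show "i = j" using ij \<open>distinct ps\<close> by (simp add: nth_eq_iff_index_eq)
  qed
  then have inj_p: "inj_on p (pverts H)"
    unfolding p_def using inj f by (meson comp_inj_on inj_on_subset)
  have off: "orientation (p u) (p v) (p w) \<noteq> 0"
    if "(u, v) \<in> parcs H" "w \<in> pverts H" "w \<noteq> u" "w \<noteq> v" for u v w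
  proof -
    have "f w \<noteq> f u" "f w \<noteq> f v" "f w < length ps"
      using that arcs[OF that(1)] inj f by (auto dest: inj_onD)
    then have "cross (ps ! f u) (ps ! f v) (ps ! f w) \<noteq> 0 \<or> cross (ps ! f v) (ps ! f u) (ps ! f w) \<noteq> 0"
      using chk_line[of "f u" "f v" "f w"] chk_line[of "f v" "f u" "f w"] arcs[OF that(1)] by metis
    then have "cross (ps ! f u) (ps ! f v) (ps ! f w) \<noteq> 0"
      by (metis cross_swap neg_equal_0_iff_equal)
    then show ?thesis by (simp add: p_def q_cross)
  qed
  have apart: "closed_segment (p u) (p v) \<inter> closed_segment (p x) (p y) = {}"
    if "(u, v) \<in> parcs H" "(x, y) \<in> parcs H" "{u, v} \<inter> {x, y} = {}" for u v x y
  proof -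
    have *: "f u \<noteq> f x" "f u \<noteq> f y" "f v \<noteq> f x" "f v \<noteq> f y"
      using that arcs[OF that(1)] arcs[OF that(2)] inj by (auto dest: inj_onD)
    have "closed_segment (q a) (q b) \<inter> closed_segment (q c) (q d) = {}"
      if "(a, b) \<in> set es" "(c, d) \<in> set es" "a \<noteq> c" "a \<noteq> d" "b \<noteq> c" "b \<noteq> d" for a b c d
    proof -
      have "cross (ps ! a) (ps ! b) (ps ! c) * cross (ps ! a) (ps ! b) (ps ! d) > 0 \<or>
        cross (ps ! c) (ps ! d) (ps ! a) * cross (ps ! c) (ps ! d) (ps ! b) > 0"
        using chk_sep[OF that(1,2)] that(3-6) by blast
      then have "orientation (q a) (q b) (q c) * orientation (q a) (q b) (q d) > 0 \<or>
        orientation (q c) (q d) (q a) * orientation (q c) (q d) (q b) > 0"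
        unfolding q_cross by (metis of_int_0_less_iff of_int_mult)
      then show ?thesis using segment_one_side by blast
    qed
    then show ?thesis
      using arcs[OF that(1)] arcs[OF that(2)] * unfolding p_def comp_apply
      by (metis closed_segment_commute)
  qed
  \<comment> \<open>A drawing assigns one curve to an unordered pair of ends; either direction of
    the segment will do.\<close>
  define \<gamma> where "\<gamma> e = (SOME g. \<exists>u v. e = {u, v} \<and> g = linepath (p u) (p v))" for e
  have \<gamma>: "\<exists>x y. {u, v} = {x, y} \<and> \<gamma> {u, v} = linepath (p x) (p y)" for u v
    using someI_ex[of "\<lambda>g. \<exists>x y. {u, v} = {x, y} \<and> g = linepath (p x) (p y)"]
    unfolding \<gamma>_def by blast
  have \<gamma>': "\<gamma> {u, v} = linepath (p u) (p v) \<or> \<gamma> {u, v} = linepath (p v) (p u)" for u v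
    using \<gamma>[of u v] by (metis doubleton_eq_iff)
  have img: "path_image (\<gamma> {u, v}) = closed_segment (p u) (p v)"
    and ends: "{pathstart (\<gamma> {u, v}), pathfinish (\<gamma> {u, v})} = {p u, p v}" for u v
    using \<gamma>'[of u v] by (auto simp: closed_segment_commute)
  have ne: "u \<noteq> v" if "(u, v) \<in> parcs H" for u v
    using chk_line[of "f u" "f v" "f u"] chk_line[of "f v" "f u" "f u"] arcs[OF that] f by auto
  have arc: "arc (\<gamma> {u, v})" if "(u, v) \<in> parcs H" for u v
  proof -
    have "p u \<noteq> p v" using ne[OF that] arcs[OF that] inj_p by (meson inj_onD)
    then show ?thesis using \<gamma>'[of u v] by (metis arc_linepath)
  qed
  have verts: "closed_segment (p u) (p v) \<inter> p ` pverts H = {p u, p v}" if "(u, v) \<in> parcs H" for u v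
  proof -
    have "w = u \<or> w = v" if "w \<in> pverts H" "p w \<in> closed_segment (p u) (p v)" for w
      using off[OF \<open>(u, v) \<in> _\<close> that(1)] orientation_segment[OF that(2)] by blast
    then show ?thesis using arcs[OF that] by auto
  qed
  have edges: "closed_segment (p u) (p v) \<inter> closed_segment (p x) (p y) \<subseteq> p ` ({u, v} \<inter> {x, y})"
    if e: "(u, v) \<in> parcs H" "(x, y) \<in> parcs H" "{u, v} \<noteq> {x, y}" for u v x y
  proof -
    have meet: "closed_segment (p a) (p b) \<inter> closed_segment (p a) (p c) \<subseteq> {p a}"
      if "(a, b) \<in> parcs H \<or> (b, a) \<in> parcs H" "c \<in> pverts H" "c \<noteq> a" "c \<noteq> b" for a b c
    proof -
      have "orientation (p a) (p b) (p c) \<noteq> 0 \<or> orientation (p b) (p a) (p c) \<noteq> 0"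
        using that off by blast
      then have "orientation (p a) (p b) (p c) \<noteq> 0" by (auto simp: orientation_def cross_def algebra_simps)
      from segments_meet_at_end[OF this] show ?thesis by simp
    qed
    consider "{u, v} \<inter> {x, y} = {}" | "u = x" "y \<noteq> v" | "u = y" "x \<noteq> v" | "v = x" "y \<noteq> u" | "v = y" "x \<noteq> u"
      using e(3) by blast
    then show ?thesis
    proof cases
      case 1 then show ?thesis using apart[OF e(1,2)] by simp
    next
      case 2 then show ?thesis using meet[of u v y] e ne[OF e(2)] arcs[OF e(2)] by auto
    next
      case 3 then show ?thesis using meet[of u v x] e ne[OF e(2)] arcs[OF e(2)] by (auto simp: closed_segment_commute)
    next
      case 4 then show ?thesis using meet[of v u y] e ne[OF e(2)] arcs[OF e(2)] by (auto simp: closed_segment_commute)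
    next
      case 5 then show ?thesis using meet[of v u x] e ne[OF e(2)] arcs[OF e(2)] by (auto simp: closed_segment_commute)
    qed
  qed
  have "plane_drawing H p \<gamma>"
    unfolding plane_drawing_def img using inj_p arc ends verts edges
    by (simp only: Ball_def split_paired_All prod.case) blast
  then show ?thesis unfolding planar_def by blast
qed

section \<open>Groups with planar generating graph\<close>

text \<open>Left multiplication by an element of the finite set \<open>M\<close> is an injective map
  of \<open>M\<close> into itself, hence onto, so \<open>M\<close> contains inverses. Thus closure
  under products, which can be tested by evaluation, makes \<open>M\<close> a subgroup.\<close>

lemma (in group) generate_subset_closed:
  assumes "finite M" "M \<subseteq> carrier G" "\<one> \<in> M"
    and closed: "\<And>x y. x \<in> M \<Longrightarrow> y \<in> M \<Longrightarrow> x \<otimes> y \<in> M" and "A \<subseteq> M"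
  shows "generate G A \<subseteq> M"
proof -
  have "inv x \<in> M" if x: "x \<in> M" for x
  proof -
    have pow: "x [^] (n::nat) \<in> M" for n
      by (induction n) (use x closed assms(3) in \<open>auto\<close>)
    have "inj_on (\<lambda>y. x \<otimes> y) M"
      using inj_on_cmult[of x] assms(2) x by (meson inj_on_subset subsetD)
    moreover have "(\<lambda>y. x \<otimes> y) ` M \<subseteq> M" using closed x by blast
    ultimately have "(\<lambda>y. x \<otimes> y) ` M = M" using assms(1) by (metis endo_inj_surj)
    then obtain y where "y \<in> M" "x \<otimes> y = \<one>" using assms(3) by (metis imageE)
    then show ?thesis using assms(2) x by (metis inv_equality inv_inv inv_closed subsetD)
  qed
  then have "subgroup M G"
    using assms by (intro subgroupI) auto
  then show ?thesis using generate_subgroup_incl[OF \<open>A \<subseteq> M\<close>] by blast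
qed

text \<open>
  The non-identity elements are numbered by their position in \<open>vs\<close>; two of them that are not joined by an
  edge in \<open>es\<close> do not generate, because they lie in one of the proper subgroups \<open>Ms\<close>.
\<close>

definition generating_graph_check ::
  "nat \<Rightarrow> (nat \<times> nat) list \<Rightarrow> 'a list \<Rightarrow> 'a \<Rightarrow> ('a \<Rightarrow> 'a \<Rightarrow> 'a) \<Rightarrow> 'a list list \<Rightarrow> bool" where
  "generating_graph_check k es vs e op Ms \<longleftrightarrow> distinct vs \<and> e \<notin> set vs \<and> length vs \<le> k \<and>
     (\<forall>i\<in>set [0..<length vs]. \<forall>j\<in>set [0..<length vs]. i = j \<or> (i, j) \<in> set es \<or> (j, i) \<in> set es \<or>
        (\<exists>M\<in>set Ms. vs ! i \<in> set M \<and> vs ! j \<in> set M)) \<and>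
     (\<forall>M\<in>set Ms. e \<in> set M \<and> (\<forall>x\<in>set M. x \<in> set (e # vs)) \<and> (\<exists>x\<in>set vs. x \<notin> set M) \<and>
        (\<forall>x\<in>set M. \<forall>y\<in>set M. op x y \<in> set M))"

text \<open>The isomorphism sends the ends of an edge to a generating pair of \<open>H\<close>. Such
  a pair cannot lie in one of the proper subgroups \<open>Ms\<close>, so the check puts it in
  \<open>es\<close>, and the drawing of \<open>es\<close> carries over.\<close>

lemma planar_generating_graph_check:
  fixes G :: "('a, 'b) monoid_scheme" and H :: "('c, 'd) monoid_scheme"
  assumes "group G" "group H" and iso: "G \<cong> H"
    and chk: "straight_line_check ps es" "generating_graph_check (length ps) es vs e op Ms"
    and H: "carrier H = set (e # vs)" "\<one>\<^bsub>H\<^esub> = e" "\<And>x y. x \<otimes>\<^bsub>H\<^esub> y = op x y"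
  shows "planar (generating_graph G)"
proof -
  interpret G: group G by fact
  interpret H: group H by fact
  obtain \<phi> where \<phi>: "\<phi> \<in> iso G H" using iso unfolding is_iso_def by blast
  interpret group_hom G H \<phi>
    using \<phi> by unfold_locales (simp add: iso_def)
  have bij: "bij_betw \<phi> (carrier G) (carrier H)" using \<phi> by (simp add: iso_def)
  note c = chk(2)[unfolded generating_graph_check_def]
  have dist: "distinct vs" "e \<notin> set vs" "length vs \<le> length ps" using c by blast+
  define idx where "idx x = (SOME i. i < length vs \<and> vs ! i = x)" for x
  have idx: "idx x < length vs \<and> vs ! idx x = x" if "x \<in> set vs" for x
    unfolding idx_def by (rule someI_ex) (use that in_set_conv_nth in metis)
  have \<phi>_vs: "\<phi> x \<in> set vs" if "x \<in> carrier G - {\<one>\<^bsub>G\<^esub>}" for x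
  proof -
    have "\<phi> x \<in> carrier H" "\<phi> x \<noteq> \<one>\<^bsub>H\<^esub>"
      using that bij hom_one inj_onD[of \<phi> "carrier G" x "\<one>\<^bsub>G\<^esub>"] by (auto simp: bij_betw_def)
    then show ?thesis using H by simp
  qed
  show ?thesis
  proof (rule planar_straight_line[OF chk(1), of "idx \<circ> \<phi>"])
    show "inj_on (idx \<circ> \<phi>) (pverts (generating_graph G))"
    proof (rule inj_onI)
      fix x y assume xy: "x \<in> pverts (generating_graph G)" "y \<in> pverts (generating_graph G)"
        "(idx \<circ> \<phi>) x = (idx \<circ> \<phi>) y"
      then have *: "x \<in> carrier G - {\<one>\<^bsub>G\<^esub>}" "y \<in> carrier G - {\<one>\<^bsub>G\<^esub>}" by (auto simp: generating_graph_def)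
      then have "\<phi> x = \<phi> y" using idx[OF \<phi>_vs] xy(3) by (metis comp_apply)
      then show "x = y" using * bij by (auto simp: bij_betw_def dest: inj_onD)
    qed
    show "(idx \<circ> \<phi>) ` pverts (generating_graph G) \<subseteq> {..<length ps}"
      using idx[OF \<phi>_vs] dist(3) by (force simp: generating_graph_def)
  next
    fix u v assume "(u, v) \<in> parcs (generating_graph G)"
    then have uv: "u \<in> carrier G - {\<one>\<^bsub>G\<^esub>}" "v \<in> carrier G - {\<one>\<^bsub>G\<^esub>}" "u \<noteq> v"
      and gen: "generate G {u, v} = carrier G" by (auto simp: generating_graph_def)
    have "generate H (\<phi> ` {u, v}) = \<phi> ` generate G {u, v}"
      using generate_img[of "{u, v}"] uv by auto
    then have genH: "generate H {\<phi> u, \<phi> v} = carrier H"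
      using gen bij by (simp add: bij_betw_def)
    have no_M: False if M: "M \<in> set Ms" "\<phi> u \<in> set M" "\<phi> v \<in> set M" for M
    proof -
      have *: "e \<in> set M \<and> (\<forall>x\<in>set M. x \<in> set (e # vs)) \<and> (\<exists>x\<in>set vs. x \<notin> set M) \<and>
        (\<forall>x\<in>set M. \<forall>y\<in>set M. op x y \<in> set M)"
        using conjunct2[OF conjunct2[OF conjunct2[OF conjunct2[OF c]]]] M(1) by (rule bspec)
      have "generate H {\<phi> u, \<phi> v} \<subseteq> set M"
      proof (rule H.generate_subset_closed)
        show "set M \<subseteq> carrier H" using * H(1) by blast
        show "x \<otimes>\<^bsub>H\<^esub> y \<in> set M" if "x \<in> set M" "y \<in> set M" for x y
          using * that unfolding H(3) by blast
      qed (use * M H(2) in simp_all)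
      moreover obtain x where "x \<in> set vs" "x \<notin> set M" using * by blast
      ultimately show False using genH H(1) by auto
    qed
    have ij: "idx (\<phi> u) < length vs" "vs ! idx (\<phi> u) = \<phi> u" "idx (\<phi> v) < length vs" "vs ! idx (\<phi> v) = \<phi> v"
      using idx[OF \<phi>_vs[OF uv(1)]] idx[OF \<phi>_vs[OF uv(2)]] by blast+
    moreover have "\<phi> u \<noteq> \<phi> v" using uv bij by (auto simp: bij_betw_def dest: inj_onD)
    ultimately have ne: "idx (\<phi> u) \<noteq> idx (\<phi> v)" by metis
    have i: "idx (\<phi> u) \<in> set [0..<length vs]" and j: "idx (\<phi> v) \<in> set [0..<length vs]"
      using ij(1,3) by auto
    have "(idx (\<phi> u), idx (\<phi> v)) \<in> set es \<or> (idx (\<phi> v), idx (\<phi> u)) \<in> set es"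
    proof -
      have "\<forall>i\<in>set [0..<length vs]. \<forall>j\<in>set [0..<length vs]. i = j \<or> (i, j) \<in> set es \<or> (j, i) \<in> set es \<or>
        (\<exists>M\<in>set Ms. vs ! i \<in> set M \<and> vs ! j \<in> set M)"
        using c by (elim conjE)
      from bspec[OF bspec[OF this i] j] show ?thesis
        using ne no_M ij(2,4) by auto
    qed
    then show "u \<in> pverts (generating_graph G) \<and> v \<in> pverts (generating_graph G) \<and>
        (((idx \<circ> \<phi>) u, (idx \<circ> \<phi>) v) \<in> set es \<or> ((idx \<circ> \<phi>) v, (idx \<circ> \<phi>) u) \<in> set es)"
      using uv by (simp add: generating_graph_def)
  qed
qed

section \<open>Drawings for the listed groups\<close>

lemma planar_integer_mod_group:
  assumes "group G" "G \<cong> integer_mod_group n" "n \<in> {2, 3, 4, 5, 6}"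
  shows "planar (generating_graph G)"
proof -
  note rule = planar_generating_graph_check[OF assms(1) group_integer_mod_group assms(2) straight_line_check_bipyramid3]
  show ?thesis
  proof (cases "n = 6")
    case True
    \<comment> \<open>The only pair not joined in the triangular bipyramid is that of the apexes, at
      positions \<open>0\<close> and \<open>4\<close>. They carry the two non-zero elements of the
      subgroup of order 3.\<close>
    show ?thesis
      by (rule rule[where vs = "[2, 1, 3, 5, 4]" and e = 0 and op = "\<lambda>x y. (x + y) mod 6" and Ms = "[[0, 2, 4]]"])
        (code_simp | use True in \<open>force simp: carrier_integer_mod_group\<close>)+
  next
    case False
    then have "set (0 # [1..int n - 1]) = carrier (integer_mod_group n)"
      using assms(3) by (auto simp: carrier_integer_mod_group)
    moreover have chk: "generating_graph_check (Suc (Suc (Suc (Suc (Suc 0))))) (bipyramid 3) [1..int m - 1] 0 (\<lambda>x y. (x + y) mod int m) []"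
      if "m \<in> set [2, 3, 4, 5]" for m
      using that by (simp only: list.set insert_iff empty_iff disj_commute) (elim disjE; simp only:; code_simp)
    ultimately show ?thesis
      using assms(3) False chk[of n]
      by (intro rule[where vs = "[1..int n - 1]" and e = 0 and op = "\<lambda>x y. (x + y) mod int n" and Ms = "[]"])
        simp_all
  qed
qed

lemma atLeastLessThan_list:
  "{0..<2::int} = set [0, 1]" "{0..<3::int} = set [0, 1, 2]" "{0..<4::int} = set [0, 1, 2, 3]"
  "{0..<6::int} = set [0, 1, 2, 3, 4, 5]"
  by auto

lemma carrier_dihedral_group:
  "carrier (dihedral_group n) = (\<lambda>i. (i, False)) ` {0..<int n} \<union> (\<lambda>i. (i, True)) ` {0..<int n}"
  by (auto simp: dihedral_group_def)

text \<open>The apexes are the two generators of the rotation subgroup and the rim consists of the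
  reflections. Reflections \<open>(i, True)\<close> and \<open>(j, True)\<close> generate only if
  \<open>i - j\<close> is a unit modulo \<open>n\<close>; for these \<open>n\<close> the units are 1
  and -1, so the rim is a cycle. The remaining rotations are isolated.\<close>

lemma planar_dihedral_group:
  assumes "group G" "G \<cong> dihedral_group n" "n \<in> {3, 4, 6}"
  shows "planar (generating_graph G)"
proof -
  have H: "group (dihedral_group n)" using assms(3) by (intro group_dihedral_group) auto
  note rule = planar_generating_graph_check[OF assms(1) H assms(2), where e = "(0, False)"
    and op = "\<lambda>(i, a) (j, b). ((if a then i - j else i + j) mod int n, a \<noteq> b)"]
  consider "n = 3" | "n = 4" | "n = 6" using assms(3) by auto
  then show ?thesis
  proof cases
    case 1
    show ?thesis
      by (rule rule[OF straight_line_check_bipyramid3, where vs = "[(1, False), (0, True), (1, True), (2, True), (2, False)]"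
            and Ms = "[[(0, False), (1, False), (2, False)]]"], unfold 1)
        (code_simp, auto simp: carrier_dihedral_group atLeastLessThan_list, simp_all add: dihedral_group_def)
  next
    case 2
    show ?thesis
      by (rule rule[OF straight_line_check_bipyramid4, where vs = "[(1, False), (0, True), (1, True), (2, True), (3, True), (3, False), (2, False)]"
            and Ms = "[[(0, False), (1, False), (2, False), (3, False)],
                       [(0, False), (2, False), (0, True), (2, True)],
                       [(0, False), (2, False), (1, True), (3, True)]]"], unfold 2)
        (code_simp, auto simp: carrier_dihedral_group atLeastLessThan_list, simp_all add: dihedral_group_def)
  next
    case 3
    show ?thesis
      by (rule rule[OF straight_line_check_bipyramid6, where vs = "[(1, False), (0, True), (1, True), (2, True), (3, True), (4, True), (5, True),
              (5, False), (2, False), (3, False), (4, False)]"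
            and Ms = "[[(0, False), (1, False), (2, False), (3, False), (4, False), (5, False)],
                       [(0, False), (2, False), (4, False), (0, True), (2, True), (4, True)],
                       [(0, False), (2, False), (4, False), (1, True), (3, True), (5, True)],
                       [(0, False), (3, False), (0, True), (3, True)],
                       [(0, False), (3, False), (1, True), (4, True)],
                       [(0, False), (3, False), (2, True), (5, True)]]"], unfold 3)
        (code_simp, auto simp: carrier_dihedral_group atLeastLessThan_list, simp_all add: dihedral_group_def)
  qed
qed

text \<open>The square bipyramid is the octahedron, whose pairs of opposite vertices carry a
  quaternion unit and its negative. The element -1 lies in all three cyclic subgroups of order 4 and
  is isolated.\<close>

lemma planar_quaternion_group:
  assumes "group G" "G \<cong> quaternion_group"
  shows "planar (generating_graph G)"
  by (rule planar_generating_graph_check[OF assms(1) group_quaternion_group assms(2) straight_line_check_bipyramid4,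
        where vs = "[(0,1,0,0), (0,0,1,0), (0,0,0,1), (0,0,-1,0), (0,0,0,-1), (0,-1,0,0), (-1,0,0,0)]"
          and e = "(1,0,0,0)" and op = quaternion_mult
          and Ms = "[[(1,0,0,0), (-1,0,0,0), (0,1,0,0), (0,-1,0,0)],
                     [(1,0,0,0), (-1,0,0,0), (0,0,1,0), (0,0,-1,0)],
                     [(1,0,0,0), (-1,0,0,0), (0,0,0,1), (0,0,0,-1)]]"])
    (code_simp, auto simp: quaternion_group_def)

lemma planar_two_by_two:
  assumes "group G" "G \<cong> integer_mod_group 2 \<times>\<times> integer_mod_group 2"
  shows "planar (generating_graph G)"
  by (rule planar_generating_graph_check[OF assms(1) _ assms(2) straight_line_check_bipyramid3,
        where vs = "[(0, 1), (1, 0), (1, 1)]" and e = "(0, 0)"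
          and op = "\<lambda>(i, j) (k, l). ((i + k) mod 2, (j + l) mod 2)" and Ms = "[]"])
    (simp add: DirProd_group, code_simp, auto simp: DirProd_def carrier_integer_mod_group atLeastLessThan_list)

text \<open>The apexes are \<open>(1, 0)\<close> and its inverse, and the rim consists of the
  \<open>(i, 1)\<close>, joined only if their first components differ by an odd number. The element
  \<open>(2, 0)\<close> lies in all three listed subgroups and is isolated.\<close>

lemma planar_four_by_two:
  assumes "group G" "G \<cong> integer_mod_group 4 \<times>\<times> integer_mod_group 2"
  shows "planar (generating_graph G)"
  by (rule planar_generating_graph_check[OF assms(1) _ assms(2) straight_line_check_bipyramid4,
        where vs = "[(1, 0), (0, 1), (1, 1), (2, 1), (3, 1), (3, 0), (2, 0)]" and e = "(0, 0)"
          and op = "\<lambda>(i, j) (k, l). ((i + k) mod 4, (j + l) mod 2)"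
          and Ms = "[[(0, 0), (1, 0), (2, 0), (3, 0)], [(0, 0), (2, 0), (0, 1), (2, 1)],
                     [(0, 0), (2, 0), (1, 1), (3, 1)]]"])
    (simp add: DirProd_group, code_simp, auto simp: DirProd_def carrier_integer_mod_group atLeastLessThan_list)

section \<open>Complete bipartite subgraphs of generating graphs\<close>

text \<open>So Euler's totient of \<open>n\<close> is at least 3: \<open>1\<close>, \<open>k\<close> and \<open>n - 1\<close> are distinct units modulo \<open>n\<close>.\<close>

lemma exists_third_unit:
  assumes "n \<ge> (5::nat)" "n \<noteq> 6"
  shows "\<exists>k::int. coprime k (int n) \<and> 1 < k \<and> k < int n - 1"
proof -
  have "\<exists>k. coprime k n \<and> 1 < k \<and> k < n - 1"
  proof (cases "even n")
    case False
    then show ?thesis using assms by (intro exI[of _ 2]) auto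
  next
    case True
    \<comment> \<open>The candidate is the first odd number after \<open>m\<close>, namely
      \<open>m + 1\<close> or \<open>m + 2\<close>; it is coprime to \<open>m\<close> and hence to
      \<open>2 * m\<close>. For odd \<open>m\<close> the bound \<open>m + 2 < n - 1\<close> requires
      \<open>m > 3\<close>, which is where 6 is excluded.\<close>
    then obtain m where m: "n = 2 * m" by blast
    show ?thesis
    proof (cases "even m")
      case True
      then have "coprime (m + 1) n" unfolding m by (simp add: coprime_Suc_left_nat)
      then show ?thesis using assms True m by (intro exI[of _ "m + 1"]) auto
    next
      case False
      then have "coprime m 2" by simp
      then have "coprime (m + 2) m" using gcd_add1[of 2 m] by (simp only: coprime_iff_gcd_eq_1 gcd.commute add.commute)
      then have "coprime (m + 2) n" unfolding m using False by simp
      then show ?thesis using assms False m by (intro exI[of _ "m + 2"]) auto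
    qed
  qed
  then obtain k where "coprime k n" "1 < k" "k < n - 1" by blast
  then show ?thesis by (intro exI[of _ "int k"]) auto
qed

section \<open>Generating pairs\<close>

context group
begin

lemma generate_pair_closed:
  assumes "a \<in> carrier G" "b \<in> carrier G"
  shows "a \<in> generate G {a, b}" "b \<in> generate G {a, b}" "\<one> \<in> generate G {a, b}"
    "u \<in> generate G {a, b} \<Longrightarrow> v \<in> generate G {a, b} \<Longrightarrow> u \<otimes> v \<in> generate G {a, b}"
    "u \<in> generate G {a, b} \<Longrightarrow> inv u \<in> generate G {a, b}"
    "u \<in> generate G {a, b} \<Longrightarrow> u [^] (i::int) \<in> generate G {a, b}"
proof -
  have sub: "subgroup (generate G {a, b}) G" using assms by (intro generate_is_subgroup) auto
  show "a \<in> generate G {a, b}" "b \<in> generate G {a, b}" by (auto intro: generate.incl)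
  show "\<one> \<in> generate G {a, b}" by (rule generate.one)
  show "u \<otimes> v \<in> generate G {a, b}" if "u \<in> generate G {a, b}" "v \<in> generate G {a, b}"
    using that by (rule generate.eng)
  show "inv u \<in> generate G {a, b}" if "u \<in> generate G {a, b}"
    using sub that by (rule subgroup.m_inv_closed)
  show "u [^] (i::int) \<in> generate G {a, b}" if "u \<in> generate G {a, b}"
    using sub that by (rule subgroup_int_pow_closed)
qed

text \<open>Unlike adjacency, this admits equal or trivial elements, so the moves below carry no
  side conditions.\<close>

definition generating_pair :: "'a \<Rightarrow> 'a \<Rightarrow> bool" where
  "generating_pair x y \<longleftrightarrow> x \<in> carrier G \<and> y \<in> carrier G \<and> generate G {x, y} = carrier G"

lemma generating_pair_in_carrier:
  "generating_pair x y \<Longrightarrow> x \<in> carrier G" "generating_pair x y \<Longrightarrow> y \<in> carrier G"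
  by (simp_all add: generating_pair_def)

lemma generating_pair_sym: "generating_pair x y \<Longrightarrow> generating_pair y x"
  by (simp add: generating_pair_def insert_commute)

lemma generating_pair_trans:
  assumes "generating_pair x y" "a \<in> carrier G" "b \<in> carrier G"
    "x \<in> generate G {a, b}" "y \<in> generate G {a, b}"
  shows "generating_pair a b"
proof -
  have "generate G {x, y} \<subseteq> generate G {a, b}"
    by (rule generate_subgroup_incl) (use assms in \<open>auto intro: generate_is_subgroup\<close>)
  then show ?thesis
    using assms generate_in_carrier[of "{a, b}"] unfolding generating_pair_def by blast
qed

text \<open>Together with multiplication of one generator by the other, inversion gives the Nielsen
  moves; each is reversible and thus preserves generation.\<close>

lemma generating_pair_inv:
  assumes "generating_pair x y"
  shows "generating_pair (inv x) y" "generating_pair x (inv y)"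
proof -
  note xy = generating_pair_in_carrier[OF assms]
  show "generating_pair (inv x) y"
    using generating_pair_trans[OF assms, of "inv x" y] generate_pair_closed[of "inv x" y] xy by (metis inv_closed inv_inv)
  show "generating_pair x (inv y)"
    using generating_pair_trans[OF assms, of x "inv y"] generate_pair_closed[of x "inv y"] xy by (metis inv_closed inv_inv)
qed

lemma generating_pair_mult_right:
  assumes "generating_pair x y"
  shows "generating_pair x (x \<otimes> y)" "generating_pair x (y \<otimes> x)"
proof -
  note xy = generating_pair_in_carrier[OF assms]
  have "y = inv x \<otimes> (x \<otimes> y)" "y = (y \<otimes> x) \<otimes> inv x" using xy by (simp_all add: m_assoc inv_solve_left)
  then show "generating_pair x (x \<otimes> y)" "generating_pair x (y \<otimes> x)"
    using generating_pair_trans[OF assms, of x "x \<otimes> y"] generating_pair_trans[OF assms, of x "y \<otimes> x"]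
      generate_pair_closed[of x "x \<otimes> y"] generate_pair_closed[of x "y \<otimes> x"] xy by (metis inv_closed m_closed)+
qed

text \<open>As \<open>k\<close> is invertible modulo the order of \<open>x\<close>, the element
  \<open>x\<close> is a power of \<open>x [^] k\<close>; then \<open>y\<close> is recovered by
  cancelling \<open>x [^] j\<close>.\<close>

lemma generating_pair_power:
  assumes "generating_pair x y" "coprime k (int (ord x))"
  shows "generating_pair (x [^] (k::int)) (y \<otimes> x [^] (j::int))"
proof -
  note xy = generating_pair_in_carrier[OF assms(1)]
  obtain u where u: "[k * u = 1] (mod int (ord x))"
    using assms(2) cong_solve_coprime_int by blast
  have "(x [^] k) [^] u = x [^] (k * u)" using xy int_pow_pow by simp
  also have "... = x [^] (1::int)" using xy u by (simp only: int_pow_eq cong_iff_dvd_diff dvd_diff_commute)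
  finally have 1: "x = (x [^] k) [^] u" using xy by simp
  let ?S = "generate G {x [^] k, y \<otimes> x [^] j}"
  note cl = generate_pair_closed[of "x [^] k" "y \<otimes> x [^] j"]
  have x: "x \<in> ?S" using cl 1 xy by (metis int_pow_closed m_closed)
  have "(y \<otimes> x [^] j) \<otimes> inv (x [^] j) = y" using xy by (simp add: m_assoc)
  then have "y \<in> ?S" using cl x xy by (metis int_pow_closed m_closed)
  then show ?thesis using generating_pair_trans[OF assms(1)] x xy by simp
qed

lemma no_K33_generating_graph:
  assumes "planar (generating_graph G)" "distinct [a1, a2, a3, b1, b2, b3]"
    and "\<one> \<notin> {a1, a2, a3, b1, b2, b3}"
    and gp: "\<And>x y. x \<in> {a1, a2, a3} \<Longrightarrow> y \<in> {b1, b2, b3} \<Longrightarrow> generating_pair x y"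
  shows False
proof (rule planar_no_K33[OF assms(1,2)])
  have "{a1, a2, a3, b1, b2, b3} \<subseteq> carrier G"
    using gp[THEN generating_pair_in_carrier(1)] gp[THEN generating_pair_in_carrier(2)] by blast
  then show "{a1, a2, a3, b1, b2, b3} \<subseteq> pverts (generating_graph G)"
    using assms(3) by (auto simp: generating_graph_def)
  then show "(x, y) \<in> parcs (generating_graph G)" if "x \<in> {a1, a2, a3}" "y \<in> {b1, b2, b3}" for x y
  proof -
    have "x \<noteq> y" "x \<noteq> \<one>" "y \<noteq> \<one>" using assms(2,3) that by auto
    then show ?thesis using gp[OF that] by (simp add: generating_graph_def generating_pair_def)
  qed
qed

section \<open>Bounds on the orders of generators\<close>

lemma planar_cyclic_imp_ord:
  assumes pl: "planar (generating_graph G)" and fin: "finite (carrier G)"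
    and g: "g \<in> carrier G" "generate G {g} = carrier G"
  shows "ord g < 7"
proof (rule ccontr)
  assume n: "\<not> ord g < 7"
  obtain k where k: "coprime k (int (ord g))" "1 < k" "k < int (ord g) - 1"
    using exists_third_unit[of "ord g"] n by auto
  have gp: "generating_pair (g [^] i) b" if "coprime i (int (ord g))" "b \<in> carrier G" for i :: int and b
  proof -
    have "generate G {g} \<subseteq> generate G {g, b}" by (rule mono_generate) simp
    then have "generating_pair g b"
      using g that generate_incl[of "{g, b}"] unfolding generating_pair_def by auto
    then have "generating_pair (g [^] i) (b \<otimes> g [^] (0::int))" using that by (intro generating_pair_power)
    then show ?thesis using that g by simp
  qed
  define a1 a2 a3 where "a1 = g [^] (1::int)" "a2 = g [^] (-1::int)" "a3 = g [^] k"
  note a = this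
  have eq: "g [^] (i::int) = g [^] (j::int) \<longleftrightarrow> int (ord g) dvd j - i" for i j
    using g(1) by (rule int_pow_eq)
  have small: "\<not> int (ord g) dvd i" if "0 < i" "i < int (ord g)" for i
    using that zdvd_not_zless by blast
  have dist: "a1 \<noteq> a2" "a1 \<noteq> a3" "a2 \<noteq> a3" "\<one> \<noteq> a1" "\<one> \<noteq> a2" "\<one> \<noteq> a3"
  proof -
    show "a1 \<noteq> a2" unfolding a eq using small[of 2] n by simp
    show "a1 \<noteq> a3" unfolding a eq using small[of "k - 1"] k by simp
    show "a2 \<noteq> a3" unfolding a eq using small[of "k + 1"] k by simp
    have one: "\<one> = g [^] (0::int)" by simp
    show "\<one> \<noteq> a1" unfolding a one eq using small[of 1] n by simp
    show "\<one> \<noteq> a2" unfolding a one eq using small[of 1] n by simp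
    show "\<one> \<noteq> a3" unfolding a one eq using small[of k] k by simp
  qed
  have "card (carrier G) = ord g"
    using g by (simp add: generate_pow_card)
  moreover have "card {\<one>, a1, a2, a3} = 4" using dist by simp
  \<comment> \<open>At least seven elements, less the identity and three generators, leave three for
    the other side; a generator is joined to each of them.\<close>
  ultimately have "3 \<le> card (carrier G - {\<one>, a1, a2, a3})"
    using n by (intro order.trans[OF _ diff_card_le_card_Diff]) auto
  then obtain T where T: "T \<subseteq> carrier G - {\<one>, a1, a2, a3}" "card T = 3"
    by (meson obtain_subset_with_card_n)
  then obtain b1 b2 b3 where b: "T = {b1, b2, b3}" "b1 \<noteq> b2" "b2 \<noteq> b3" "b1 \<noteq> b3"
    using card_3_iff by metis
  show False
  proof (rule no_K33_generating_graph[OF pl, of a1 a2 a3 b1 b2 b3])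
    show "generating_pair x y" if "x \<in> {a1, a2, a3}" "y \<in> {b1, b2, b3}" for x y
      using that T(1) b(1) gp k(1) unfolding a by auto
  qed (use b T dist in \<open>auto\<close>)
qed

text \<open>If one member of a generating pair were in the cyclic group generated by the other, that
  cyclic group would be all of \<open>G\<close>.\<close>

lemma noncyclic_generating_pair:
  assumes nc: "\<And>g. g \<in> carrier G \<Longrightarrow> generate G {g} \<noteq> carrier G" and "generating_pair x y"
  shows "x \<notin> generate G {y}" "y \<notin> generate G {x}" "x \<noteq> y" "x \<noteq> inv y" "x \<noteq> \<one>" "y \<noteq> \<one>"
proof -
  have *: "v \<notin> generate G {u}" if "generating_pair u v" for u v
  proof
    assume v: "v \<in> generate G {u}"
    have u: "u \<in> carrier G" "v \<in> carrier G" using that generating_pair_in_carrier by blast+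
    have "generate G {u, v} \<subseteq> generate G {u}"
      by (rule generate_subgroup_incl) (use v u in \<open>auto intro: generate.incl generate_is_subgroup\<close>)
    then have "generate G {u} = carrier G"
      using that u generate_incl[of "{u}"] unfolding generating_pair_def by auto
    then show False using nc u by blast
  qed
  show 1: "x \<notin> generate G {y}" "y \<notin> generate G {x}" using * assms(2) generating_pair_sym by blast+
  have "y \<in> generate G {y}" "\<one> \<in> generate G {y}" "\<one> \<in> generate G {x}" "inv y \<in> generate G {y}"
    by (auto intro: generate.intros)
  then show "x \<noteq> y" "x \<noteq> inv y" "x \<noteq> \<one>" "y \<noteq> \<one>" using 1 by auto
qed

text \<open>In a noncyclic group the members of a generating pair are distinct and non-trivial, so
  only distinctness within each side remains to be shown.\<close>

lemma no_K33_noncyclic: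
  assumes nc: "\<And>g. g \<in> carrier G \<Longrightarrow> generate G {g} \<noteq> carrier G"
    and pl: "planar (generating_graph G)"
    and dist: "distinct [a1, a2, a3]" "distinct [b1, b2, b3]"
    and gp: "\<And>x y. x \<in> {a1, a2, a3} \<Longrightarrow> y \<in> {b1, b2, b3} \<Longrightarrow> generating_pair x y"
  shows False
proof (rule no_K33_generating_graph[OF pl _ _ gp])
  have ne: "x \<noteq> y \<and> x \<noteq> \<one> \<and> y \<noteq> \<one>" if "x \<in> {a1, a2, a3}" "y \<in> {b1, b2, b3}" for x y
    using noncyclic_generating_pair[OF nc gp[OF that]] by blast
  show "distinct [a1, a2, a3, b1, b2, b3]"
    using dist ne[of a1 b1] ne[of a1 b2] ne[of a1 b3] ne[of a2 b1] ne[of a2 b2] ne[of a2 b3]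
      ne[of a3 b1] ne[of a3 b2] ne[of a3 b3] by auto
  show "\<one> \<notin> {a1, a2, a3, b1, b2, b3}" using ne by blast
qed

lemma planar_noncyclic_imp_ord:
  assumes nc: "\<And>g. g \<in> carrier G \<Longrightarrow> generate G {g} \<noteq> carrier G"
    and pl: "planar (generating_graph G)" and fin: "finite (carrier G)" and xy: "generating_pair x y"
  shows "ord x \<in> {2, 3, 4, 6}"
proof (rule ccontr)
  assume o: "ord x \<notin> {2, 3, 4, 6}"
  have x: "x \<in> carrier G" "y \<in> carrier G" using xy generating_pair_in_carrier by blast+
  have "ord x \<noteq> 1" "ord x > 0"
    using noncyclic_generating_pair[OF nc xy] x ord_ge_1[OF fin x(1)] ord_eq_1 by auto
  then have n: "ord x \<ge> 5" "ord x \<noteq> 6" using o by auto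
  then obtain k where k: "coprime k (int (ord x))" "1 < k" "k < int (ord x) - 1"
    using exists_third_unit[of "ord x"] by auto
  have eq: "x [^] (i::int) = x [^] (j::int) \<longleftrightarrow> int (ord x) dvd j - i" for i j
    using x(1) by (rule int_pow_eq)
  have small: "\<not> int (ord x) dvd i" if "0 < i" "i < int (ord x)" for i
    using that zdvd_not_zless by blast
  show False
  proof (rule no_K33_noncyclic[OF nc pl])
    \<comment> \<open>The exponents differ by 2, \<open>k - 1\<close> and \<open>k + 1\<close>, all
      strictly between 0 and the order of \<open>x\<close>.\<close>
    show "distinct [x [^] (1::int), x [^] (-1::int), x [^] k]"
      using small[of 2] small[of "k - 1"] small[of "k + 1"] k n by (simp only: distinct.simps list.set insert_iff empty_iff eq) simp
    show "distinct [y \<otimes> x [^] (0::int), y \<otimes> x [^] (1::int), y \<otimes> x [^] (2::int)]"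
    proof -
      have "y \<otimes> x [^] i = y \<otimes> x [^] j \<longleftrightarrow> int (ord x) dvd j - i" for i j :: int
        using x eq by simp
      then show ?thesis
        using small[of 1] small[of 2] n by (simp only: distinct.simps list.set insert_iff empty_iff) simp
    qed
    show "generating_pair u v"
      if "u \<in> {x [^] (1::int), x [^] (-1::int), x [^] k}"
        "v \<in> {y \<otimes> x [^] (0::int), y \<otimes> x [^] (1::int), y \<otimes> x [^] (2::int)}" for u v
      using that k(1)
      by (elim insertE emptyE)
        (simp_all only: generating_pair_power[OF xy] coprime_1_left coprime_minus_left_iff)
  qed
qed

text \<open>Both choices of \<open>c\<close> arise from the product of \<open>x\<close> and
  \<open>y\<close> by right multiplication with \<open>x\<close> or \<open>inv x\<close>. By Nielsen
  moves \<open>c\<close> therefore generates with \<open>x\<close>, with \<open>inv x\<close> and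
  with that product, and would complete a complete bipartite graph if it were new.\<close>

lemma noninvolutions_normalise:
  assumes nc: "\<And>g. g \<in> carrier G \<Longrightarrow> generate G {g} \<noteq> carrier G"
    and pl: "planar (generating_graph G)" and xy: "generating_pair x y"
    and x2: "x \<noteq> inv x" and y2: "y \<noteq> inv y" and c: "c = x \<otimes> y \<otimes> x \<or> c = x \<otimes> y \<otimes> inv x"
  shows "c = y \<or> c = inv y"
proof (rule ccontr)
  assume ne: "\<not> (c = y \<or> c = inv y)"
  note car = generating_pair_in_carrier[OF xy]
  have gxxy: "generating_pair x (x \<otimes> y)" using generating_pair_mult_right[OF xy] by simp
  have gxyy: "generating_pair (x \<otimes> y) y"
    using generating_pair_mult_right(2)[OF generating_pair_sym[OF xy]] generating_pair_sym by simp
  have gxyc: "generating_pair (x \<otimes> y) c"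
    using c generating_pair_mult_right(1)[OF generating_pair_sym[OF gxxy]]
      generating_pair_mult_right(1)[OF generating_pair_inv(2)[OF generating_pair_sym[OF gxxy]]] by auto
  have gxc: "generating_pair x c"
    using c generating_pair_mult_right(2)[OF gxxy]
      generating_pair_mult_right(2)[OF generating_pair_inv(1)[OF gxxy]] generating_pair_inv(1)[of "inv x" c] car
    by auto
  show False
  proof (rule no_K33_noncyclic[OF nc pl])
    show "distinct [x, inv x, x \<otimes> y]"
      using x2 noncyclic_generating_pair[OF nc gxxy] noncyclic_generating_pair[OF nc generating_pair_sym[OF gxxy]] by auto
    show "distinct [y, inv y, c]" using y2 ne by auto
    show "generating_pair u v" if "u \<in> {x, inv x, x \<otimes> y}" "v \<in> {y, inv y, c}" for u v
      using that xy gxc gxyc gxyy generating_pair_inv by blast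
  qed
qed

text \<open>
  Every element of \<open>G\<close> is uniquely of the form \<open>x\<^sup>i y\<^sup>a\<close> with \<open>a \<in> {0, 1}\<close>; the bijection \<open>\<psi>\<close> identifies the
  resulting multiplication table with that of \<open>H\<close>.
\<close>

lemma metacyclic_iso:
  fixes k m :: int and H :: "('c, 'd) monoid_scheme"
  assumes fin: "finite (carrier G)" and xy: "generating_pair x y" and ny: "y \<notin> generate G {x}"
    and conj: "y \<otimes> x \<otimes> inv y = x [^] k" and sq: "y \<otimes> y = x [^] m"
    and \<psi>: "bij_betw \<psi> ({0..<int (ord x)} \<times> UNIV) (carrier H)"
    and hom: "\<And>i j a b. i \<in> {0..<int (ord x)} \<Longrightarrow> j \<in> {0..<int (ord x)} \<Longrightarrow>
      \<psi> ((i + (if a then k * j else j) + (if a \<and> b then m else 0)) mod int (ord x), a \<noteq> b) = \<psi> (i, a) \<otimes>\<^bsub>H\<^esub> \<psi> (j, b)"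
  shows "G \<cong> H"
proof -
  note car = generating_pair_in_carrier[OF xy]
  define n where "n = int (ord x)"
  have n: "n > 0" using ord_ge_1[OF fin car(1)] n_def by simp
  define F where "F = (\<lambda>(i::int, a). x [^] i \<otimes> (if a then y else \<one>))"
  define D where "D = {0..<n} \<times> (UNIV :: bool set)"
  have F_car: "F p \<in> carrier G" for p using car by (cases p) (simp add: F_def)
  have pow_mod: "x [^] (i mod n) = x [^] i" for i
    using car(1) by (simp add: int_pow_eq n_def mod_eq_dvd_iff[symmetric])
  \<comment> \<open>Conjugation by \<open>y\<close> is a homomorphism, so its value on
    \<open>x\<close> determines how \<open>y\<close> moves past every power of
    \<open>x\<close>.\<close>
  interpret c: group_hom G G "\<lambda>z. y \<otimes> z \<otimes> inv y"
  proof (unfold_locales, rule homI)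
    fix u v assume "u \<in> carrier G" "v \<in> carrier G"
    moreover have "inv y \<otimes> (y \<otimes> w) = w" if "w \<in> carrier G" for w
      using that car by (simp flip: m_assoc)
    ultimately show "y \<otimes> (u \<otimes> v) \<otimes> inv y = y \<otimes> u \<otimes> inv y \<otimes> (y \<otimes> v \<otimes> inv y)"
      using car by (simp add: m_assoc)
  qed (use car in simp)
  have move: "y \<otimes> x [^] j = x [^] (k * j) \<otimes> y" for j :: int
  proof -
    have "y \<otimes> x [^] j \<otimes> inv y = x [^] (k * j)"
      using c.hom_int_pow[OF car(1), of j] conj car by (simp add: int_pow_pow)
    then show ?thesis using car by (metis int_pow_closed inv_solve_right m_closed)
  qed
  have F_mult: "F (i, a) \<otimes> F (j, b) = F ((i + (if a then k * j else j) + (if a \<and> b then m else 0)) mod n, a \<noteq> b)" for i j a b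
  proof -
    have "F (i, a) \<otimes> F (j, b) = x [^] (i + (if a then k * j else j)) \<otimes> ((if a then y else \<one>) \<otimes> (if b then y else \<one>))"
    proof (cases a)
      case True
      have "F (i, a) \<otimes> F (j, b) = x [^] i \<otimes> (y \<otimes> x [^] j) \<otimes> (if b then y else \<one>)"
        using car True by (simp add: F_def m_assoc)
      also have "... = x [^] (i + k * j) \<otimes> (y \<otimes> (if b then y else \<one>))"
        using car by (simp add: move m_assoc int_pow_mult)
      finally show ?thesis using True by simp
    next
      case False
      then show ?thesis using car by (simp add: F_def m_assoc int_pow_mult)
    qed
    then show ?thesis
      using car by (auto simp: F_def pow_mod sq int_pow_mult m_assoc split: if_splits)
  qed
  have powers: "x [^] (i::int) \<in> generate G {x}" for i
    using generate_pow[OF car(1)] by blast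
  have "inj_on F D"
  proof (rule inj_onI)
    fix p q assume pq: "p \<in> D" "q \<in> D" "F p = F q"
    obtain i a j b where ij: "p = (i, a)" "q = (j, b)" by fastforce
    \<comment> \<open>Otherwise \<open>y\<close> would be a power of \<open>x\<close>, against
      \<open>ny\<close>.\<close>
    have ab: "a = b"
    proof (rule ccontr)
      assume "a \<noteq> b"
      have "\<exists>(i::int) (j::int). x [^] i \<otimes> y = x [^] j"
      proof (cases a)
        case True
        then have "x [^] i \<otimes> y = x [^] j" using pq(3) \<open>a \<noteq> b\<close> car by (simp add: F_def ij)
        then show ?thesis by blast
      next
        case False
        then have "x [^] j \<otimes> y = x [^] i" using pq(3) \<open>a \<noteq> b\<close> car by (simp add: F_def ij)
        then show ?thesis by blast
      qed
      then obtain i j :: int where e: "x [^] i \<otimes> y = x [^] j" by blast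
      have "y = inv (x [^] i) \<otimes> x [^] j"
        using car by (simp add: e[symmetric] flip: m_assoc)
      also have "... = x [^] (- i + j)" using int_pow_mult[OF car(1), of "- i" j] int_pow_neg[OF car(1), of i] by simp
      finally show False using ny powers by simp
    qed
    have "x [^] i = x [^] j"
      using pq(3) car unfolding ij F_def ab by (auto split: if_splits)
    then have "n dvd j - i" using car by (simp add: int_pow_eq n_def)
    moreover have "0 \<le> i" "i < n" "0 \<le> j" "j < n" using pq(1,2) by (auto simp: D_def ij)
    moreover have "j mod n = i mod n" using \<open>n dvd j - i\<close> by (simp add: mod_eq_dvd_iff)
    ultimately have "i = j" by simp
    then show "p = q" using ij ab by simp
  qed
  moreover have "carrier G \<subseteq> F ` D"
  proof -
    \<comment> \<open>Writing \<open>1 mod n\<close> instead of 1 keeps the exponent in range also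
      for \<open>n = 1\<close>.\<close>
    have "F (0, False) = \<one>" "F (0, True) = y" "F (1 mod n, False) = x"
      using car pow_mod[of 1] by (simp_all add: F_def)
    moreover have "(0, False) \<in> D" "(0, True) \<in> D" "(1 mod n, False) \<in> D" using n by (auto simp: D_def)
    ultimately have *: "\<one> \<in> F ` D" "{x, y} \<subseteq> F ` D" by (metis image_eqI, metis image_eqI insert_subset empty_subsetI)
    have "generate G {x, y} \<subseteq> F ` D"
    proof (rule generate_subset_closed[OF _ _ *(1) _ *(2)])
      show "finite (F ` D)" by (simp add: D_def)
      show "F ` D \<subseteq> carrier G" using F_car by blast
      fix u v assume "u \<in> F ` D" "v \<in> F ` D"
      then obtain i a j b where "u = F (i, a)" "v = F (j, b)" by (metis imageE surj_pair)
      then have "u \<otimes> v = F ((i + (if a then k * j else j) + (if a \<and> b then m else 0)) mod n, a \<noteq> b)"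
        by (simp only: F_mult)
      moreover have "(((i + (if a then k * j else j) + (if a \<and> b then m else 0)) mod n, a \<noteq> b)) \<in> D"
        using n by (simp add: D_def)
      ultimately show "u \<otimes> v \<in> F ` D" by (rule image_eqI)
    qed
    then show ?thesis using xy by (simp add: generating_pair_def)
  qed
  ultimately have F_bij: "bij_betw F D (carrier G)" using F_car by (auto simp: bij_betw_def)
  have F_inv: "inv_into D F u \<in> D" "F (inv_into D F u) = u" if "u \<in> carrier G" for u
    using that F_bij by (auto simp: bij_betw_def inv_into_into f_inv_into_f)
  have "\<psi> \<circ> inv_into D F \<in> iso G H"
  proof (rule isoI)
    show "bij_betw (\<psi> \<circ> inv_into D F) (carrier G) (carrier H)"
      using bij_betw_trans[OF bij_betw_inv_into[OF F_bij]] \<psi> by (simp add: D_def n_def)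
    show "\<psi> \<circ> inv_into D F \<in> hom G H"
    proof (rule homI)
      fix u v assume uv: "u \<in> carrier G" "v \<in> carrier G"
      obtain i a j b where p: "inv_into D F u = (i, a)" "inv_into D F v = (j, b)" by fastforce
      let ?r = "((i + (if a then k * j else j) + (if a \<and> b then m else 0)) mod n, a \<noteq> b)"
      have "u \<otimes> v = F ?r" using F_inv(2)[OF uv(1)] F_inv(2)[OF uv(2)] F_mult[of i a j b] p by simp
      moreover have "?r \<in> D" using n by (simp add: D_def)
      ultimately have "inv_into D F (u \<otimes> v) = ?r" using F_bij by (simp add: bij_betw_def inv_into_f_f)
      moreover have "i \<in> {0..<n}" "j \<in> {0..<n}" using F_inv(1)[OF uv(1)] F_inv(1)[OF uv(2)] p by (auto simp: D_def)
      ultimately show "(\<psi> \<circ> inv_into D F) (u \<otimes> v) = (\<psi> \<circ> inv_into D F) u \<otimes>\<^bsub>H\<^esub> (\<psi> \<circ> inv_into D F) v"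
        using hom[of i j a b] p unfolding n_def by simp
    next
      fix u assume "u \<in> carrier G"
      then show "(\<psi> \<circ> inv_into D F) u \<in> carrier H"
        using F_inv(1) \<psi> by (auto simp: bij_betw_def D_def n_def)
    qed
  qed
  then show ?thesis unfolding is_iso_def by blast
qed

section \<open>Classification\<close>

lemma cyclic_iso_integer_mod_group:
  assumes fin: "finite (carrier G)" and g: "g \<in> carrier G" "generate G {g} = carrier G"
  shows "G \<cong> integer_mod_group (ord g)"
proof -
  define n where "n = int (ord g)"
  have n: "n > 0" using ord_ge_1[OF fin g(1)] n_def by simp
  have car: "carrier (integer_mod_group (ord g)) = {0..<n}"
    using n by (simp add: carrier_integer_mod_group n_def)
  have eq: "g [^] i = g [^] j \<longleftrightarrow> i mod n = j mod n" for i j :: int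
    using int_pow_eq[OF g(1), of i j] mod_eq_dvd_iff[of j n i] by (auto simp: n_def)
  have "([^]) g \<in> iso (integer_mod_group (ord g)) G"
  proof (rule isoI)
    show "([^]) g \<in> hom (integer_mod_group (ord g)) G"
    proof (rule homI)
      fix i j
      have "g [^] ((i + j) mod n) = g [^] (i + j)" by (simp add: eq)
      then show "g [^] (i \<otimes>\<^bsub>integer_mod_group (ord g)\<^esub> j) = g [^] i \<otimes> g [^] j"
        using g(1) by (simp add: n_def int_pow_mult)
    qed (use g(1) in simp)
    have "inj_on (([^]) g) {0..<n}" by (rule inj_onI) (simp add: eq)
    moreover have "u \<in> ([^]) g ` {0..<n}" if u: "u \<in> carrier G" for u
    proof -
      obtain i :: int where "u = g [^] i" using u g generate_pow[OF g(1)] by auto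
      then have "u = g [^] (i mod n)" by (simp add: eq)
      then show ?thesis using n by (intro image_eqI[of _ _ "i mod n"]) auto
    qed
    ultimately show "bij_betw (([^]) g) (carrier (integer_mod_group (ord g))) (carrier G)"
      using g(1) unfolding bij_betw_def car by auto
  qed
  then show ?thesis
    using group.iso_sym[OF group_integer_mod_group] unfolding is_iso_def by blast
qed

text \<open>The product of two involutions plays the rotation: conjugation by \<open>t\<close> turns
  it into the product in the opposite order, which is its inverse. The dihedral group is encoded in
  the same normal form, so the bijection is the identity.\<close>

lemma involutions_iso_dihedral_group:
  assumes nc: "\<And>g. g \<in> carrier G \<Longrightarrow> generate G {g} \<noteq> carrier G"
    and fin: "finite (carrier G)" and st: "generating_pair s t" and s2: "inv s = s" and t2: "inv t = t"
  shows "G \<cong> dihedral_group (ord (s \<otimes> t))"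
proof (rule metacyclic_iso[where x = "s \<otimes> t" and y = t and k = "-1" and m = 0 and \<psi> = id])
  note car = generating_pair_in_carrier[OF st]
  show st': "generating_pair (s \<otimes> t) t"
    using generating_pair_mult_right(2)[OF generating_pair_sym[OF st]] generating_pair_sym by blast
  show "t \<notin> generate G {s \<otimes> t}" using noncyclic_generating_pair[OF nc st'] by blast
  have tt: "t \<otimes> t = \<one>" using r_inv[OF car(2)] t2 by simp
  then show "t \<otimes> t = (s \<otimes> t) [^] (0::int)" by simp
  have "t \<otimes> (s \<otimes> t) \<otimes> inv t = t \<otimes> s" using car tt t2 by (simp add: m_assoc)
  also have "... = inv (s \<otimes> t)" using car s2 t2 by (simp add: inv_mult_group)
  also have "... = (s \<otimes> t) [^] (-1::int)" using car int_pow_neg[of "s \<otimes> t" 1] by simp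
  finally show "t \<otimes> (s \<otimes> t) \<otimes> inv t = (s \<otimes> t) [^] (-1::int)" .
qed (use fin in \<open>auto simp: dihedral_group_def bij_betw_def\<close>)

lemma involution_product_iso:
  assumes nc: "\<And>g. g \<in> carrier G \<Longrightarrow> generate G {g} \<noteq> carrier G"
    and fin: "finite (carrier G)" and xt: "generating_pair x t" and t2: "t \<otimes> t = \<one>"
    and comm: "t \<otimes> x = x \<otimes> t"
  shows "G \<cong> integer_mod_group (ord x) \<times>\<times> integer_mod_group 2"
proof (rule metacyclic_iso[where x = x and y = t and k = 1 and m = 0 and \<psi> = "\<lambda>(i, a). (i, if a then 1 else 0)"])
  note car = generating_pair_in_carrier[OF xt]
  show "t \<notin> generate G {x}" using noncyclic_generating_pair[OF nc xt] by blast
  show "t \<otimes> t = x [^] (0::int)" using t2 by simp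
  show "t \<otimes> x \<otimes> inv t = x [^] (1::int)" using car comm by (simp add: m_assoc)
  have n: "ord x > 0" using ord_ge_1[OF fin car(1)] by simp
  let ?\<psi> = "\<lambda>(i :: int, a). (i, if a then 1 else 0 :: int)"
  have c2: "carrier (integer_mod_group 2) = {0, 1}" by (auto simp: carrier_integer_mod_group)
  have onto: "z \<in> ?\<psi> ` ({0..<int (ord x)} \<times> UNIV)" if "z \<in> {0..<int (ord x)} \<times> {0, 1}" for z
    using that by (intro image_eqI[of _ _ "(fst z, snd z = 1)"]) auto
  have "?\<psi> ` ({0..<int (ord x)} \<times> UNIV) = {0..<int (ord x)} \<times> {0, 1}"
    by (intro subset_antisym subsetI onto) (auto split: if_splits)
  moreover have "inj_on ?\<psi> ({0..<int (ord x)} \<times> UNIV)"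
    by (rule inj_onI) (auto split: if_splits)
  ultimately show "bij_betw ?\<psi> ({0..<int (ord x)} \<times> UNIV)
      (carrier (integer_mod_group (ord x) \<times>\<times> integer_mod_group 2))"
    using n c2 by (simp add: bij_betw_def DirProd_def carrier_integer_mod_group)
  fix i j :: int and a b
  assume "i \<in> {0..<int (ord x)}" "j \<in> {0..<int (ord x)}"
  then show "(case ((i + (if a then 1 * j else j) + (if a \<and> b then 0 else 0)) mod int (ord x), a \<noteq> b) of
          (i, a) \<Rightarrow> (i, if a then 1 else 0)) =
        (case (i, a) of (i, a) \<Rightarrow> (i, if a then 1 else 0)) \<otimes>\<^bsub>integer_mod_group (ord x) \<times>\<times> integer_mod_group 2\<^esub>
        (case (j, b) of (i, a) \<Rightarrow> (i, if a then 1 else 0))"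
    by (auto simp: DirProd_def)
qed (use fin xt in auto)

lemma iso_quaternion_group:
  assumes nc: "\<And>g. g \<in> carrier G \<Longrightarrow> generate G {g} \<noteq> carrier G"
    and fin: "finite (carrier G)" and xy: "generating_pair x y" and ord: "ord x = 4"
    and conj: "y \<otimes> x \<otimes> inv y = inv x" and sq: "y \<otimes> y = x \<otimes> x"
  shows "G \<cong> quaternion_group"
proof -
  note car = generating_pair_in_carrier[OF xy]
  \<comment> \<open>Here \<open>x\<close> goes to i and \<open>y\<close> to j: the lists hold the
    products of 1, i, -1, -i with j and with 1, respectively.\<close>
  define \<psi> :: "int \<times> bool \<Rightarrow> int \<times> int \<times> int \<times> int" where
    "\<psi> = (\<lambda>(i, a). if a then [(0,0,1,0), (0,0,0,1), (0,0,-1,0), (0,0,0,-1)] ! nat i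
                  else [(1,0,0,0), (0,1,0,0), (-1,0,0,0), (0,-1,0,0)] ! nat i)"
  have four: "{0..<4::int} = {0, 1, 2, 3}" by auto
  show ?thesis
  proof (rule metacyclic_iso[OF fin xy, where k = "-1" and m = 2 and \<psi> = \<psi>])
    show "y \<notin> generate G {x}" using noncyclic_generating_pair[OF nc xy] by blast
    show "y \<otimes> x \<otimes> inv y = x [^] (-1::int)" using conj car int_pow_neg[of x 1] by simp
    show "y \<otimes> y = x [^] (2::int)" using sq car int_pow_mult[of x 1 1] by simp
    have D: "{0..<4::int} \<times> UNIV = {(0, False), (1, False), (2, False), (3, False), (0, True), (1, True), (2, True), (3, True)}"
      by auto
    show "bij_betw \<psi> ({0..<int (ord x)} \<times> UNIV) (carrier quaternion_group)"
      unfolding bij_betw_def ord of_nat_numeral D by (auto simp: \<psi>_def quaternion_group_def)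
    fix i j :: int and a b
    assume "i \<in> {0..<int (ord x)}" "j \<in> {0..<int (ord x)}"
    then have "i \<in> {0, 1, 2, 3}" "j \<in> {0, 1, 2, 3}" unfolding ord of_nat_numeral four .
    then show "\<psi> ((i + (if a then - 1 * j else j) + (if a \<and> b then 2 else 0)) mod int (ord x), a \<noteq> b) =
        \<psi> (i, a) \<otimes>\<^bsub>quaternion_group\<^esub> \<psi> (j, b)"
      unfolding ord of_nat_numeral
      by (cases a; cases b) (auto simp: \<psi>_def quaternion_group_def)
  qed
qed

section \<open>Noncyclic groups with planar generating graph\<close>

lemma planar_commuting_involution:
  assumes nc: "\<And>g. g \<in> carrier G \<Longrightarrow> generate G {g} \<noteq> carrier G"
    and pl: "planar (generating_graph G)" and fin: "finite (carrier G)"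
    and xt: "generating_pair x t" and t2: "t \<otimes> t = \<one>" and comm: "t \<otimes> x = x \<otimes> t" and x2: "x \<noteq> inv x"
  shows "ord x = 4"
proof (rule ccontr)
  assume "ord x \<noteq> 4"
  note car = generating_pair_in_carrier[OF xt]
  have "x \<otimes> x \<noteq> \<one>" using x2 car by (metis inv_equality)
  then have "ord x \<noteq> 2" using pow_eq_id[OF car(1), of 2] car by (auto simp: numeral_2_eq_2)
  then have o: "ord x = 3 \<or> ord x = 6"
    using planar_noncyclic_imp_ord[OF nc pl fin xt] \<open>ord x \<noteq> 4\<close> by auto
  have pow: "(x \<otimes> t) [^] i = x [^] i \<otimes> t [^] i" for i :: int
    using car comm by (simp add: int_pow_mult_distrib)
  have t_even: "t [^] (2 * i) = \<one>" for i :: int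
    using car t2 int_pow_pow[of t 2 i] int_pow_mult[of t 1 1] by simp
  have x_mod: "x [^] i = x [^] j \<longleftrightarrow> int (ord x) dvd j - i" for i j :: int
    using car(1) by (rule int_pow_eq)
  show False
  proof (cases "ord x = 3")
    case True
    \<comment> \<open>In this case the product of \<open>x\<close> and \<open>t\<close> alone
      generates: its fourth power is \<open>x\<close> and its third power is \<open>t\<close>, so
      \<open>G\<close> would be cyclic.\<close>
    have "(x \<otimes> t) [^] (4::int) = x" using pow[of 4] t_even[of 2] x_mod[of 4 1] True car by simp
    moreover have "(x \<otimes> t) [^] (3::int) = t"
      using pow[of 3] t_even[of 1] x_mod[of 3 0] int_pow_mult[of t 2 1] True car by simp
    ultimately have "generating_pair (x \<otimes> t) (x \<otimes> t)"
      using generating_pair_trans[OF xt, of "x \<otimes> t" "x \<otimes> t"] generate_pair_closed[of "x \<otimes> t" "x \<otimes> t"] car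
      by (metis m_closed)
    then show False using noncyclic_generating_pair(3)[OF nc] by blast
  next
    case False
    then have o: "ord x = 6" using o by simp
    have gp: "generating_pair x (x \<otimes> t)" "generating_pair (x \<otimes> t) t"
      using generating_pair_mult_right[OF xt] generating_pair_mult_right(2)[OF generating_pair_sym[OF xt]]
        generating_pair_sym by auto
    show False
    proof (rule no_K33_noncyclic[OF nc pl])
      show "distinct [x, inv x, x \<otimes> t]"
        using x2 noncyclic_generating_pair[OF nc gp(1)] noncyclic_generating_pair[OF nc generating_pair_sym[OF gp(1)]] by auto
      have "t \<otimes> x [^] i = t \<otimes> x [^] j \<longleftrightarrow> int (ord x) dvd j - i" for i j :: int
        using car x_mod by simp
      then show "distinct [t \<otimes> x [^] (2 * 0 :: int), t \<otimes> x [^] (2 * 1 :: int), t \<otimes> x [^] (2 * 2 :: int)]"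
        by (simp only: distinct.simps list.set insert_iff empty_iff) (simp add: o)
      have "generating_pair x (t \<otimes> x [^] i)" for i :: int
        using generating_pair_power[OF xt, of 1 i] car by simp
      \<comment> \<open>Even powers of \<open>x\<close> agree with those of the product of
        \<open>x\<close> and \<open>t\<close>, so multiplying \<open>t\<close> by them keeps a
        generating pair with that product as well as with \<open>x\<close>.\<close>
      moreover have "generating_pair (x \<otimes> t) (t \<otimes> x [^] (2 * i))" for i :: int
        using generating_pair_power[OF gp(2), of 1 "2 * i"] car pow[of "2 * i"] t_even[of i] by simp
      ultimately show "generating_pair u v" if "u \<in> {x, inv x, x \<otimes> t}"
        "v \<in> {t \<otimes> x [^] (2 * 0 :: int), t \<otimes> x [^] (2 * 1 :: int), t \<otimes> x [^] (2 * 2 :: int)}" for u v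
        using that generating_pair_inv(1) by blast
    qed
  qed
qed

lemma planar_noninvolutions_classification:
  assumes nc: "\<And>g. g \<in> carrier G \<Longrightarrow> generate G {g} \<noteq> carrier G"
    and pl: "planar (generating_graph G)" and fin: "finite (carrier G)"
    and xy: "generating_pair x y" and x2: "x \<noteq> inv x" and y2: "y \<noteq> inv y"
  shows "G \<cong> quaternion_group \<or> G \<cong> integer_mod_group 4 \<times>\<times> integer_mod_group 2"
proof -
  note car = generating_pair_in_carrier[OF xy]
  have cancel: "inv u \<otimes> (u \<otimes> v) = v" "u \<otimes> (inv u \<otimes> v) = v" if "u \<in> carrier G" "v \<in> carrier G" for u v
    using that by (simp_all flip: m_assoc)
  \<comment> \<open>The two elements differ because \<open>x\<close> is not an involution, so one of
    them is \<open>y\<close> and the other is \<open>inv y\<close>.\<close>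
  have "x \<otimes> y \<otimes> x \<noteq> x \<otimes> y \<otimes> inv x" using x2 car by simp
  moreover note noninvolutions_normalise[OF nc pl xy x2 y2, of "x \<otimes> y \<otimes> x"]
    noninvolutions_normalise[OF nc pl xy x2 y2, of "x \<otimes> y \<otimes> inv x"]
  ultimately consider (quat) "x \<otimes> y \<otimes> x = y" "x \<otimes> y \<otimes> inv x = inv y"
    | (comm) "x \<otimes> y \<otimes> x = inv y" "x \<otimes> y \<otimes> inv x = y" by metis
  then show ?thesis
  proof cases
    case quat
    have "x \<otimes> (y \<otimes> x \<otimes> inv y) = \<one>" using quat(1) car by (metis inv_closed m_assoc m_closed r_inv)
    then have conj: "y \<otimes> x \<otimes> inv y = inv x" using car by (metis inv_closed inv_equality inv_comm m_closed)
    have "y \<otimes> inv x \<otimes> inv x = x \<otimes> y \<otimes> inv x"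
      by (subst quat(1)[symmetric]) (use car in \<open>simp add: m_assoc\<close>)
    then have "y \<otimes> (inv x \<otimes> inv x) = inv y" using quat(2) car by (simp add: m_assoc)
    then have "inv x \<otimes> inv x = inv y \<otimes> inv y" using car cancel(1)[of y "inv x \<otimes> inv x"] by simp
    then have sq: "y \<otimes> y = x \<otimes> x" using car by (metis inv_inv inv_mult_group m_closed)
    \<comment> \<open>The square of \<open>x\<close> is also that of \<open>y\<close>, so
      conjugation by \<open>y\<close> fixes it; but it also inverts it. Hence the fourth power of
      \<open>x\<close> is trivial.\<close>
    have "x \<otimes> x = y \<otimes> (x \<otimes> x) \<otimes> inv y" using car by (simp add: sq[symmetric] m_assoc)
    also have "... = (y \<otimes> x \<otimes> inv y) \<otimes> (y \<otimes> x \<otimes> inv y)" using car by (simp add: m_assoc cancel)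
    also have "... = inv (x \<otimes> x)" using car conj by (simp add: inv_mult_group)
    finally have "(x \<otimes> x) \<otimes> (x \<otimes> x) = \<one>" using car by (metis m_closed r_inv)
    then have "x [^] (4::nat) = \<one>" using car by (simp add: numeral_eq_Suc m_assoc)
    then have "ord x dvd 4" using pow_eq_id[OF car(1)] by simp
    moreover have "ord x = 0 \<or> ord x = 1 \<or> ord x = 2 \<or> ord x = 3 \<or> ord x = 4"
      using dvd_imp_le[OF \<open>ord x dvd 4\<close>] by linarith
    moreover have "\<not> ord x dvd 2"
      using pow_eq_id[OF car(1), of 2] x2 car by (auto simp: numeral_2_eq_2 dest: inv_equality)
    ultimately have "ord x = 4" by auto
    then show ?thesis using iso_quaternion_group[OF nc fin xy _ conj sq] by blast
  next
    case comm
    have c: "x \<otimes> y = y \<otimes> x" using comm(2) car by (metis inv_solve_right m_closed)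
    \<comment> \<open>The square of \<open>t\<close> is the product of \<open>inv y\<close> and
      \<open>y\<close>, so replacing \<open>y\<close> by \<open>t\<close> gives a commuting pair
      with an involution.\<close>
    define t where "t = x \<otimes> y"
    have "t \<otimes> t = x \<otimes> y \<otimes> x \<otimes> y" using car by (simp add: t_def m_assoc)
    then have t2: "t \<otimes> t = \<one>" using comm(1) car by simp
    have tx: "t \<otimes> x = x \<otimes> t" using car by (simp add: t_def m_assoc flip: c)
    have xt: "generating_pair x t" using generating_pair_mult_right[OF xy] t_def by simp
    have "ord x = 4" by (rule planar_commuting_involution[OF nc pl fin xt t2 tx x2])
    then show ?thesis using involution_product_iso[OF nc fin xt t2 tx] by simp
  qed
qed

text \<open>The product of \<open>s\<close> and \<open>t\<close> has order 2, 3, 4 or 6. Order 2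
  means that the involutions commute, and the dihedral group is then the direct product of two
  groups of order 2.\<close>

lemma planar_involutions_classification:
  assumes nc: "\<And>g. g \<in> carrier G \<Longrightarrow> generate G {g} \<noteq> carrier G"
    and pl: "planar (generating_graph G)" and fin: "finite (carrier G)"
    and st: "generating_pair s t" and s2: "inv s = s" and t2: "inv t = t"
  shows "G \<cong> integer_mod_group 2 \<times>\<times> integer_mod_group 2 \<or> (\<exists>n\<in>{3, 4, 6}. G \<cong> dihedral_group n)"
proof -
  note car = generating_pair_in_carrier[OF st]
  have st': "generating_pair (s \<otimes> t) t"
    using generating_pair_mult_right(2)[OF generating_pair_sym[OF st]] generating_pair_sym by blast
  have tt: "t \<otimes> t = \<one>" using r_inv[OF car(2)] t2 by simp
  show ?thesis
  proof (cases "ord (s \<otimes> t) = 2")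
    case True
    then have "(s \<otimes> t) \<otimes> (s \<otimes> t) = \<one>" using pow_eq_id[of "s \<otimes> t" 2] car by (simp add: numeral_2_eq_2)
    then have "inv (s \<otimes> t) = s \<otimes> t" using car by (metis inv_equality m_closed)
    then have "t \<otimes> s = s \<otimes> t" using car s2 t2 by (simp add: inv_mult_group)
    then have "t \<otimes> (s \<otimes> t) = (s \<otimes> t) \<otimes> t" using car by (simp flip: m_assoc)
    then show ?thesis using involution_product_iso[OF nc fin st' tt] True by simp
  next
    case False
    then have "ord (s \<otimes> t) \<in> {3, 4, 6}" using planar_noncyclic_imp_ord[OF nc pl fin st'] by auto
    then show ?thesis using involutions_iso_dihedral_group[OF nc fin st s2 t2] by blast
  qed
qed

lemma planar_noncyclic_classification:
  assumes nc: "\<And>g. g \<in> carrier G \<Longrightarrow> generate G {g} \<noteq> carrier G"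
    and pl: "planar (generating_graph G)" and fin: "finite (carrier G)" and xy: "generating_pair x y"
  shows "G \<cong> quaternion_group \<or> G \<cong> integer_mod_group 4 \<times>\<times> integer_mod_group 2 \<or>
    G \<cong> integer_mod_group 2 \<times>\<times> integer_mod_group 2 \<or> (\<exists>n\<in>{3, 4, 6}. G \<cong> dihedral_group n)"
proof (cases "\<exists>u v. generating_pair u v \<and> u \<noteq> inv u \<and> v \<noteq> inv v")
  case True
  then show ?thesis using planar_noninvolutions_classification[OF nc pl fin] by blast
next
  case False
  \<comment> \<open>Any two of \<open>x\<close>, \<open>y\<close> and their product generate. Since
    no generating pair consists of two elements that differ from their inverses, at most one of the
    three does.\<close>
  have "generating_pair x (x \<otimes> y)" "generating_pair (x \<otimes> y) y"
    using generating_pair_mult_right(1)[OF xy]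
      generating_pair_mult_right(2)[OF generating_pair_sym[OF xy]] generating_pair_sym by blast+
  then have "\<exists>s t. generating_pair s t \<and> inv s = s \<and> inv t = t"
    using xy False by metis
  then show ?thesis using planar_involutions_classification[OF nc pl fin] by blast
qed

end

theorem theorem1:
  fixes G :: "('a, 'b) monoid_scheme"
  assumes "group G"
    and "finite (carrier G)"
    and "carrier G \<noteq> {\<one>\<^bsub>G\<^esub>}"
    and "two_generated G"
  shows "planar (generating_graph G) \<longleftrightarrow>
      G \<cong> integer_mod_group 2 \<or>
      G \<cong> integer_mod_group 3 \<or>
      G \<cong> integer_mod_group 4 \<or>
      G \<cong> integer_mod_group 5 \<or>
      G \<cong> integer_mod_group 6 \<or>
      G \<cong> integer_mod_group 2 \<times>\<times> integer_mod_group 2 \<or>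
      G \<cong> dihedral_group 4 \<or>
      G \<cong> quaternion_group \<or>
      G \<cong> integer_mod_group 4 \<times>\<times> integer_mod_group 2 \<or>
      G \<cong> dihedral_group 3 \<or>
      G \<cong> dihedral_group 6"
proof -
  interpret G: group G by fact
  show ?thesis
  proof
    assume pl: "planar (generating_graph G)"
    show "G \<cong> integer_mod_group 2 \<or>
      G \<cong> integer_mod_group 3 \<or>
      G \<cong> integer_mod_group 4 \<or>
      G \<cong> integer_mod_group 5 \<or>
      G \<cong> integer_mod_group 6 \<or>
      G \<cong> integer_mod_group 2 \<times>\<times> integer_mod_group 2 \<or>
      G \<cong> dihedral_group 4 \<or>
      G \<cong> quaternion_group \<or>
      G \<cong> integer_mod_group 4 \<times>\<times> integer_mod_group 2 \<or>
      G \<cong> dihedral_group 3 \<or>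
      G \<cong> dihedral_group 6"
    proof (cases "\<exists>g\<in>carrier G. generate G {g} = carrier G")
      case True
      then obtain g where g: "g \<in> carrier G" "generate G {g} = carrier G" by blast
      \<comment> \<open>Order 1 belongs to the trivial group, whose empty generating graph is planar
        although the group is not listed.\<close>
      have "G.ord g \<noteq> 1"
        using assms(3) g G.ord_eq_1 G.generate_one by auto
      then have "G.ord g \<in> {2, 3, 4, 5, 6}"
        using G.planar_cyclic_imp_ord[OF pl assms(2) g] G.ord_ge_1[OF assms(2) g(1)] by auto
      then show ?thesis using G.cyclic_iso_integer_mod_group[OF assms(2) g] by auto
    next
      case False
      obtain x y where "G.generating_pair x y"
        using assms(4) unfolding two_generated_def G.generating_pair_def by blast
      then show ?thesis using G.planar_noncyclic_classification[OF _ pl assms(2)] False by blast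
    qed
  next
    note planar = planar_integer_mod_group[OF assms(1)] planar_dihedral_group[OF assms(1)]
      planar_quaternion_group[OF assms(1)] planar_two_by_two[OF assms(1)] planar_four_by_two[OF assms(1)]
    show "planar (generating_graph G)" if "G \<cong> integer_mod_group 2 \<or>
      G \<cong> integer_mod_group 3 \<or>
      G \<cong> integer_mod_group 4 \<or>
      G \<cong> integer_mod_group 5 \<or>
      G \<cong> integer_mod_group 6 \<or>
      G \<cong> integer_mod_group 2 \<times>\<times> integer_mod_group 2 \<or>
      G \<cong> dihedral_group 4 \<or>
      G \<cong> quaternion_group \<or>
      G \<cong> integer_mod_group 4 \<times>\<times> integer_mod_group 2 \<or>
      G \<cong> dihedral_group 3 \<or>
      G \<cong> dihedral_group 6"
      using that by (elim disjE) (erule planar, simp?)+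
  qed
qed

end
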